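(* Let $E$ and $X$ be complex Banach spaces. Suppose that $k\in\mathbb{R}$, $1\le q<\infty$, $1/q'+1/q=1$ and $(R(t))_{t>0}\subseteq L(E,X)$ is a strongly continuous operator family such that, for every $s\ge 0$, $$m_s:=\sum_{j=0}^{\infty}\|R(\cdot)\|_{L^{q'}[s+j,s+j+1]}<\infty.$$ Suppose, further, that the Stepanov $q$-bounded functions $g:\mathbb{R}\to E$ and $h:[0,\infty)\to E$ are such that $g$ is Stepanov $q$-semi-Bloch $k$-periodic (respectively, Stepanov $q$-semi-anti-periodic) and $\hat h\in C_0([0,\infty):L^q([0,1]:E))$, and let $f(t)=g(t)+h(t)$ for all $t\ge 0$. Let there exist a finite number $M>0$ such that the following holds: (i) $\lim_{t\to+\infty}\int_t^{t+1}\Bigl[\int_M^s\|R(r)\|\,\|h(s-r)\|\,dr\Bigr]^q ds=0$; (ii) $\lim_{t\to+\infty}\int_t^{t+1}m_s^q\,ds=0$. Then the function $H:[0,\infty)\to X$ given by $$H(t):=\int_0^t R(t-s)f(s)\,ds,\quad t\ge 0,$$ is well-defined, bounded and asymptotically Stepanov $q$-semi-Bloch $k$-periodic (respectively, asymptotically Stepanov $q$-semi-anti-periodic).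
   Context: $L(E,X)$ is the space of bounded linear operators from $E$ to $X$. Here $\|R(\cdot)\|_{L^{q'}[a,b]}$ denotes the $L^{q'}$-norm over $[a,b]$ of the scalar function $t\mapsto\|R(t)\|_{L(E,X)}$ (with $q'=\infty$ if $q=1$). Let $I=\mathbb{R}$ or $I=[0,\infty)$ and let $Y$ be a complex Banach space. $C_b(I:Y)$ is the space of bounded continuous functions $I\to Y$; $C_0([0,\infty):Y)$ is the subspace of $C_b([0,\infty):Y)$ of functions vanishing at infinity. A function $f\in C_b(\mathbb{R}:Y)$ is semi-Bloch $k$-periodic if for every $\varepsilon>0$ there exists $p>0$ such that for all $m\in\mathbb{Z}$ and all $x\in\mathbb{R}$ one has $\|f(x+mp)-e^{ikmp}f(x)\|\le\varepsilon$. It is semi-anti-periodic if for every $\varepsilon>0$ there exists $p>0$ such that for all $m\in\mathbb{Z}$ and all $x\in\mathbb{R}$ one has $\|f(x+mp)-(-1)^m f(x)\|\le\varepsilon$. A function $f\in C_b([0,\infty):Y)$ is asymptotically semi-Bloch $k$-periodic (respectively, asymptotically semi-anti-periodic) if there exist $\phi\in C_0([0,\infty):Y)$ and a semi-Bloch $k$-periodic (respectively, semi-anti-periodic) function $u:\mathbb{R}\to Y$ such that $f(t)=u(t)+\phi(t)$ for all $t\ge 0$. A function $f\in L^q_{loc}(I:Y)$ is Stepanov $q$-bounded, written $f\in L^q_S(I:Y)$, if $\sup_{t\in I}\bigl(\int_t^{t+1}\|f(s)\|^q\,ds\bigr)^{1/q}<\infty$. For such $f$ define $\hat f:I\to L^q([0,1]:Y)$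 by $\hat f(t)(s):=f(t+s)$, $t\in I$, $s\in[0,1]$. A function $f\in L^q_S(\mathbb{R}:Y)$ is Stepanov $q$-semi-Bloch $k$-periodic (respectively, Stepanov $q$-semi-anti-periodic) if $\hat f$ is semi-Bloch $k$-periodic (respectively, semi-anti-periodic). A function $f\in L^q_S([0,\infty):Y)$ is asymptotically Stepanov $q$-semi-Bloch $k$-periodic (respectively, asymptotically Stepanov $q$-semi-anti-periodic) if $\hat f:[0,\infty)\to L^q([0,1]:Y)$ is asymptotically semi-Bloch $k$-periodic (respectively, asymptotically semi-anti-periodic). *)

theory Defs
  imports
    "HOL-Analysis.Analysis"
    "HOL-Library.Function_Algebras"
    "HOL-Probability.Essential_Supremum"
begin

section \<open>Complex normed spaces\<close>

text \<open>The norm of a complex Banach space is modelled on top of the real class hierarchy: a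
  complex Banach space is a type of sort \<open>{complex_normed_vector, banach}\<close>, and
  \<open>L(E,X)\<close> consists of the bounded (real-)linear functions that satisfy \<open>complex_linear\<close>.
  The norm of \<open>blinfun\<close> is the operator norm of \<open>L(E,X)\<close>.\<close>

class scaleC =
  fixes scaleC :: "complex \<Rightarrow> 'a \<Rightarrow> 'a"  (infixr \<open>*\<^sub>C\<close> 75)

class complex_vector = scaleC + ab_group_add +
  assumes scaleC_add_right: "a *\<^sub>C (x + y) = a *\<^sub>C x + a *\<^sub>C y"
    and scaleC_add_left: "(a + b) *\<^sub>C x = a *\<^sub>C x + b *\<^sub>C x"
    and scaleC_scaleC: "a *\<^sub>C b *\<^sub>C x = (a * b) *\<^sub>C x"
    and scaleC_one: "1 *\<^sub>C x = x"

class complex_normed_vector = complex_vector + real_normed_vector +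
  assumes scaleR_scaleC: "r *\<^sub>R x = complex_of_real r *\<^sub>C x"
    and norm_scaleC: "norm (a *\<^sub>C x) = cmod a * norm x"

instantiation complex :: complex_normed_vector
begin

definition scaleC_complex :: "complex \<Rightarrow> complex \<Rightarrow> complex"
  where "scaleC_complex a x = a * x"

instance
  by standard
    (auto simp: scaleC_complex_def algebra_simps norm_mult scaleR_conv_of_real)

end

instantiation "fun" :: (type, complex_vector) complex_vector
begin

definition scaleC_fun :: "complex \<Rightarrow> ('a \<Rightarrow> 'b) \<Rightarrow> 'a \<Rightarrow> 'b"
  where "scaleC_fun a f = (\<lambda>x. a *\<^sub>C f x)"

instance
  by standard
    (auto simp: scaleC_fun_def fun_eq_iff scaleC_add_right scaleC_add_left scaleC_scaleC scaleC_one)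

end

definition complex_linear :: "('a::complex_vector \<Rightarrow> 'b::complex_vector) \<Rightarrow> bool"
  where "complex_linear T \<longleftrightarrow>
    (\<forall>x y. T (x + y) = T x + T y) \<and> (\<forall>c x. T (c *\<^sub>C x) = c *\<^sub>C T x)"

definition strongly_continuous_on ::
    "real set \<Rightarrow> (real \<Rightarrow> ('a::real_normed_vector \<Rightarrow>\<^sub>L 'b::real_normed_vector)) \<Rightarrow> bool"
  where "strongly_continuous_on S R \<longleftrightarrow> (\<forall>x. continuous_on S (\<lambda>t. blinfun_apply (R t) x))"


section \<open>Bochner integration without separability\<close>

text \<open>The Bochner integral of HOL-Analysis is restricted to second countable target spaces. The
  following is the same definition for an arbitrary normed target space, where measurability
  is replaced by strong measurability (a.e. limit of simple functions).\<close>

definition strongly_measurable :: "'a measure \<Rightarrow> ('a \<Rightarrow> 'b::real_normed_vector) \<Rightarrow> bool"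
  where "strongly_measurable M f \<longleftrightarrow>
    (\<exists>s. (\<forall>i::nat. simple_function M (s i)) \<and> (AE x in M. (\<lambda>i. s i x) \<longlonglongrightarrow> f x))"

definition has_bochner :: "'a measure \<Rightarrow> ('a \<Rightarrow> 'b::real_normed_vector) \<Rightarrow> 'b \<Rightarrow> bool"
  where "has_bochner M f y \<longleftrightarrow> strongly_measurable M f \<and>
    (\<exists>s. (\<forall>i::nat. Bochner_Integration.simple_bochner_integrable M (s i)) \<and>
         (\<lambda>i. \<integral>\<^sup>+x. ennreal (norm (f x - s i x)) \<partial>M) \<longlonglongrightarrow> 0 \<and>
         (\<lambda>i. Bochner_Integration.simple_bochner_integral M (s i)) \<longlonglongrightarrow> y)"

definition bochner_integrable :: "'a measure \<Rightarrow> ('a \<Rightarrow> 'b::real_normed_vector) \<Rightarrow> bool"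
  where "bochner_integrable M f \<longleftrightarrow> (\<exists>y. has_bochner M f y)"

definition bochner_integral :: "'a measure \<Rightarrow> ('a \<Rightarrow> 'b::real_normed_vector) \<Rightarrow> 'b"
  where "bochner_integral M f = (THE y. has_bochner M f y)"


section \<open>Lebesgue norms and spaces\<close>

text \<open>Real powers of extended nonnegative reals, intended for exponents \<open>p > 0\<close>.\<close>

definition ennreal_powr :: "ennreal \<Rightarrow> real \<Rightarrow> ennreal"
  where "ennreal_powr a p = (if a = \<infinity> then \<infinity> else ennreal (enn2real a powr p))"

text \<open>Intended for exponents \<open>1 \<le> p \<le> \<infinity>\<close>.\<close>

definition eLp_norm :: "ennreal \<Rightarrow> 'a measure \<Rightarrow> ('a \<Rightarrow> 'b::real_normed_vector) \<Rightarrow> ennreal"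
  where "eLp_norm p M f =
    (if p = \<infinity> then esssup M (\<lambda>x. ennreal (norm (f x)))
     else ennreal_powr (\<integral>\<^sup>+x. ennreal (norm (f x) powr enn2real p) \<partial>M) (1 / enn2real p))"

text \<open>Elements of \<open>L\<^sup>p\<close> are represented by functions; two functions represent the
  same element iff the seminorm \<open>Lp_norm\<close> of their difference vanishes.\<close>

definition Lp_space :: "ennreal \<Rightarrow> 'a measure \<Rightarrow> ('a \<Rightarrow> 'b::real_normed_vector) set"
  where "Lp_space p M = {f. strongly_measurable M f \<and> eLp_norm p M f < \<infinity>}"

definition Lp_norm :: "ennreal \<Rightarrow> 'a measure \<Rightarrow> ('a \<Rightarrow> 'b::real_normed_vector) \<Rightarrow> real"
  where "Lp_norm p M f = enn2real (eLp_norm p M f)"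

definition Lp_loc :: "ennreal \<Rightarrow> real set \<Rightarrow> (real \<Rightarrow> 'b::real_normed_vector) set"
  where "Lp_loc p I = {f. \<forall>K. compact K \<and> K \<subseteq> I \<longrightarrow> f \<in> Lp_space p (lebesgue_on K)}"


section \<open>Semi-periodic functions with values in a seminormed space\<close>

text \<open>The target space \<open>Y\<close> is given by a carrier \<open>V\<close> and a seminorm \<open>N\<close>, and stands
  for the normed space obtained by identifying \<open>v\<close> and \<open>w\<close> when \<open>N (v - w) = 0\<close>. It is
  instantiated below with \<open>L\<^sup>q([0,1]:Y)\<close>; an ordinary Banach space is the case of
  \<open>UNIV\<close> and \<open>norm\<close>.\<close>

definition C_b :: "'v::complex_vector set \<Rightarrow> ('v \<Rightarrow> real) \<Rightarrow> real set \<Rightarrow> (real \<Rightarrow> 'v) set"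
  where "C_b V N I = {f. (\<forall>t\<in>I. f t \<in> V) \<and>
    (\<forall>t\<in>I. ((\<lambda>s. N (f s - f t)) \<longlongrightarrow> 0) (at t within I)) \<and>
    (\<exists>B. \<forall>t\<in>I. N (f t) \<le> B)}"

definition C_0 :: "'v::complex_vector set \<Rightarrow> ('v \<Rightarrow> real) \<Rightarrow> (real \<Rightarrow> 'v) set"
  where "C_0 V N = {f \<in> C_b V N {0..}. ((\<lambda>t. N (f t)) \<longlongrightarrow> 0) at_top}"

definition semi_bloch_periodic ::
    "'v::complex_vector set \<Rightarrow> ('v \<Rightarrow> real) \<Rightarrow> real \<Rightarrow> (real \<Rightarrow> 'v) \<Rightarrow> bool"
  where "semi_bloch_periodic V N k f \<longleftrightarrow> f \<in> C_b V N UNIV \<and>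
    (\<forall>\<epsilon>>0. \<exists>p>0. \<forall>m::int. \<forall>x.
       N (f (x + of_int m * p) - exp (\<i> * complex_of_real (k * of_int m * p)) *\<^sub>C f x) \<le> \<epsilon>)"

definition semi_anti_periodic ::
    "'v::complex_vector set \<Rightarrow> ('v \<Rightarrow> real) \<Rightarrow> (real \<Rightarrow> 'v) \<Rightarrow> bool"
  where "semi_anti_periodic V N f \<longleftrightarrow> f \<in> C_b V N UNIV \<and>
    (\<forall>\<epsilon>>0. \<exists>p>0. \<forall>m::int. \<forall>x.
       N (f (x + of_int m * p) - ((-1) powi m) *\<^sub>C f x) \<le> \<epsilon>)"

definition asymptotically_semi_bloch_periodic ::
    "'v::complex_vector set \<Rightarrow> ('v \<Rightarrow> real) \<Rightarrow> real \<Rightarrow> (real \<Rightarrow> 'v) \<Rightarrow> bool"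
  where "asymptotically_semi_bloch_periodic V N k f \<longleftrightarrow> f \<in> C_b V N {0..} \<and>
    (\<exists>\<phi> u. \<phi> \<in> C_0 V N \<and> semi_bloch_periodic V N k u \<and>
       (\<forall>t\<ge>0. N (f t - (u t + \<phi> t)) = 0))"

definition asymptotically_semi_anti_periodic ::
    "'v::complex_vector set \<Rightarrow> ('v \<Rightarrow> real) \<Rightarrow> (real \<Rightarrow> 'v) \<Rightarrow> bool"
  where "asymptotically_semi_anti_periodic V N f \<longleftrightarrow> f \<in> C_b V N {0..} \<and>
    (\<exists>\<phi> u. \<phi> \<in> C_0 V N \<and> semi_anti_periodic V N u \<and>
       (\<forall>t\<ge>0. N (f t - (u t + \<phi> t)) = 0))"


section \<open>Stepanov classes\<close>

definition stepanov_bounded :: "real \<Rightarrow> real set \<Rightarrow> (real \<Rightarrow> 'a::real_normed_vector) \<Rightarrow> bool"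
  where "stepanov_bounded q I f \<longleftrightarrow> f \<in> Lp_loc (ennreal q) I \<and>
    (SUP t\<in>I. eLp_norm (ennreal q) (lebesgue_on {t..t+1}) f) < \<infinity>"

definition hat :: "(real \<Rightarrow> 'a) \<Rightarrow> real \<Rightarrow> real \<Rightarrow> 'a"
  where "hat f t = (\<lambda>s. f (t + s))"

abbreviation Lq01 :: "real \<Rightarrow> (real \<Rightarrow> 'a::real_normed_vector) set"
  where "Lq01 q \<equiv> Lp_space (ennreal q) (lebesgue_on {0..1})"

abbreviation Lq01_norm :: "real \<Rightarrow> (real \<Rightarrow> 'a::real_normed_vector) \<Rightarrow> real"
  where "Lq01_norm q \<equiv> Lp_norm (ennreal q) (lebesgue_on {0..1})"

definition stepanov_semi_bloch_periodic ::
    "real \<Rightarrow> real \<Rightarrow> (real \<Rightarrow> 'a::complex_normed_vector) \<Rightarrow> bool"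
  where "stepanov_semi_bloch_periodic q k f \<longleftrightarrow> stepanov_bounded q UNIV f \<and>
    semi_bloch_periodic (Lq01 q) (Lq01_norm q) k (hat f)"

definition stepanov_semi_anti_periodic ::
    "real \<Rightarrow> (real \<Rightarrow> 'a::complex_normed_vector) \<Rightarrow> bool"
  where "stepanov_semi_anti_periodic q f \<longleftrightarrow> stepanov_bounded q UNIV f \<and>
    semi_anti_periodic (Lq01 q) (Lq01_norm q) (hat f)"

definition asymptotically_stepanov_semi_bloch_periodic ::
    "real \<Rightarrow> real \<Rightarrow> (real \<Rightarrow> 'a::complex_normed_vector) \<Rightarrow> bool"
  where "asymptotically_stepanov_semi_bloch_periodic q k f \<longleftrightarrow> stepanov_bounded q {0..} f \<and>
    asymptotically_semi_bloch_periodic (Lq01 q) (Lq01_norm q) k (hat f)"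

definition asymptotically_stepanov_semi_anti_periodic ::
    "real \<Rightarrow> (real \<Rightarrow> 'a::complex_normed_vector) \<Rightarrow> bool"
  where "asymptotically_stepanov_semi_anti_periodic q f \<longleftrightarrow> stepanov_bounded q {0..} f \<and>
    asymptotically_semi_anti_periodic (Lq01 q) (Lq01_norm q) (hat f)"

end

theory Submission
  imports Defs
begin

text \<open>The whole theorem rests on one estimate for the convolution
  \<open>(R * F)(t) = \<integral>\<^sub>0\<^sup>\<infinity> R(s) F(t - s) ds\<close>. Cutting the half-line into the unit intervals \<open>[j, j + 1]\<close>
  and applying Hoelder's inequality on each of them gives
  \<open>\<parallel>(R * F)(t') - c (R * G)(t)\<parallel> \<le> \<Sum>\<^sub>j w\<^sub>j \<parallel>F(t' - j - 1 + \<cdot>) - c G(t - j - 1 + \<cdot>)\<parallel>\<close>, where the norm on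
  the right is that of \<open>L\<^sup>q[0,1]\<close> and \<open>w\<^sub>j = \<parallel>R\<parallel>\<close> in \<open>L\<^sup>q\<^sup>'[j, j + 1]\<close>; the weights
  sum to \<open>m 0 < \<infinity>\<close> (\<open>norm_conv_diff_le\<close>). So every property of the Stepanov translates
  of \<open>F\<close> and \<open>G\<close> which is stable under dominated summation passes to ordinary norms of
  the convolutions: boundedness, continuity, \<open>\<epsilon>\<close>-closeness of \<open>F(\<cdot> + p)\<close> to \<open>c F\<close> with the
  same \<open>p\<close> and \<open>c\<close>, and convergence to \<open>0\<close> at infinity.

  Let \<open>F\<close> be \<open>f\<close> on \<open>[0, \<infinity>)\<close> and \<open>0\<close> on the negative half-line. Then \<open>H = R * F\<close> on
  \<open>[0, \<infinity>)\<close>, the periodic part is \<open>u = R * g\<close>, and the correction is \<open>\<phi> = R * F - R * g\<close>. The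
  estimate bounds \<open>\<phi>(t)\<close> by a series whose \<open>j\<close>-th term involves, once \<open>t \<ge> j + 1\<close>, only the
  translate of \<open>h\<close> by \<open>t - j - 1\<close>; each term tends to \<open>0\<close>, the series is dominated by a
  multiple of \<open>\<Sum>\<^sub>j w\<^sub>j\<close>, and Tannery's theorem yields \<open>\<phi>(t) \<rightarrow> 0\<close>. Both Bloch periodicity and
  anti-periodicity come from the same transfer of almost periods (\<open>conv_almost_period\<close>), with
  \<open>c = e\<^sup>i\<^sup>k\<^sup>m\<^sup>p\<close> or \<open>c = (-1)\<^sup>m\<close>.

  Two points need separate care. The integrand \<open>s \<mapsto> R(s) F(t - s)\<close> must be strongly
  measurable, although \<open>R\<close> is only strongly continuous and the spaces need not be separable:
  discretising time and approximating \<open>F\<close> simultaneously converges because of the uniform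
  boundedness principle (\<open>strongly_measurable_blinfun_apply\<close>). And the jump of \<open>F\<close> at \<open>0\<close> must
  not destroy the continuity of its Stepanov translates (\<open>hat_truncated_continuous\<close>).\<close>

section \<open>Strong measurability\<close>

lemma strongly_measurable_AE_cong:
  assumes "strongly_measurable M f" "AE x in M. f x = g x"
  shows "strongly_measurable M g"
proof -
  obtain s where s: "\<And>i::nat. simple_function M (s i)" and lim: "AE x in M. (\<lambda>i. s i x) \<longlonglongrightarrow> f x"
    using assms(1) unfolding strongly_measurable_def by blast
  have "AE x in M. (\<lambda>i. s i x) \<longlonglongrightarrow> g x"
    using lim assms(2) by eventually_elim simp
  with s show ?thesis unfolding strongly_measurable_def by blast
qed

lemma strongly_measurable_continuous2:
  assumes f: "strongly_measurable M f" and g: "strongly_measurable M g"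
    and T: "continuous_on UNIV (\<lambda>p. T (fst p) (snd p))"
  shows "strongly_measurable M (\<lambda>x. T (f x) (g x))"
proof -
  obtain s where s: "\<And>i::nat. simple_function M (s i)" and ls: "AE x in M. (\<lambda>i. s i x) \<longlonglongrightarrow> f x"
    using f unfolding strongly_measurable_def by blast
  obtain r where r: "\<And>i::nat. simple_function M (r i)" and lr: "AE x in M. (\<lambda>i. r i x) \<longlonglongrightarrow> g x"
    using g unfolding strongly_measurable_def by blast
  have "simple_function M (\<lambda>x. T (s i x) (r i x))" for i
    by (rule simple_function_compose2[OF s r])
  moreover have "AE x in M. (\<lambda>i. T (s i x) (r i x)) \<longlonglongrightarrow> T (f x) (g x)"
    using ls lr
  proof eventually_elim
    case (elim x)
    then show ?case
      using continuous_on_tendsto_compose[OF T tendsto_Pair[OF elim]] by simp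
  qed
  ultimately show ?thesis unfolding strongly_measurable_def by (intro exI[of _ "\<lambda>i x. T (s i x) (r i x)"]) blast
qed

lemma strongly_measurable_diff:
  assumes "strongly_measurable M f" "strongly_measurable M g"
  shows "strongly_measurable M (\<lambda>x. f x - g x)"
  by (rule strongly_measurable_continuous2[OF assms]) (intro continuous_intros)

lemma strongly_measurable_add:
  assumes "strongly_measurable M f" "strongly_measurable M g"
  shows "strongly_measurable M (\<lambda>x. f x + g x)"
  by (rule strongly_measurable_continuous2[OF assms]) (intro continuous_intros)

lemma bounded_linear_scaleC: "bounded_linear (\<lambda>x::'a::complex_normed_vector. c *\<^sub>C x)"
proof (rule bounded_linear_intro[where K="cmod c"])
  show "c *\<^sub>C (r *\<^sub>R x) = r *\<^sub>R (c *\<^sub>C x)" for r and x::'a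
    by (simp add: scaleR_scaleC scaleC_scaleC mult.commute)
qed (simp_all add: scaleC_add_right norm_scaleC)

lemma strongly_measurable_scaleC:
  fixes f :: "'a \<Rightarrow> 'b::complex_normed_vector"
  assumes "strongly_measurable M f"
  shows "strongly_measurable M (\<lambda>x. c *\<^sub>C f x)"
  by (rule strongly_measurable_continuous2[OF assms assms])
    (intro bounded_linear.continuous_on[OF bounded_linear_scaleC] continuous_intros)

lemma strongly_measurable_restrict:
  assumes f: "strongly_measurable M f" and S: "S \<inter> space M \<in> sets M"
  shows "strongly_measurable (restrict_space M S) f"
proof -
  obtain s where s: "\<And>i::nat. simple_function M (s i)" and ls: "AE x in M. (\<lambda>i. s i x) \<longlonglongrightarrow> f x"
    using f unfolding strongly_measurable_def by blast
  have "simple_function (restrict_space M S) (s i)" for i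
    unfolding simple_function_restrict_space[OF S]
    using simple_function_If_set[OF s[of i] simple_function_const[of M 0] S]
    by (rule back_subst[of "simple_function M"]) (auto simp: indicator_def)
  moreover have "AE x in restrict_space M S. (\<lambda>i. s i x) \<longlonglongrightarrow> f x"
    using ls unfolding AE_restrict_space_iff[OF S] by eventually_elim simp
  ultimately show ?thesis unfolding strongly_measurable_def by blast
qed

text \<open>Gluing: after making the pieces disjoint, the \<open>i\<close>-th approximant is the sum of the \<open>i\<close>-th
  approximants on the first \<open>i\<close> pieces, so that it is simple, and every point eventually sees
  exactly the approximants of the one piece which contains it.\<close>

lemma strongly_measurable_countable_cover:
  assumes "\<And>n::nat. strongly_measurable (restrict_space M (A n)) f"
    and A: "\<And>n. A n \<in> sets M" and cover: "space M \<subseteq> (\<Union>n. A n)"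
  shows "strongly_measurable M f"
proof -
  have "\<exists>s. (\<forall>i::nat. simple_function M (\<lambda>x. indicator (A n) x *\<^sub>R s i x)) \<and>
          (AE x in M. x \<in> A n \<longrightarrow> (\<lambda>i. s i x) \<longlonglongrightarrow> f x)" for n
  proof -
    have An: "A n \<inter> space M \<in> sets M" using A[of n] by auto
    show ?thesis
      using assms(1)[of n] unfolding strongly_measurable_def
      by (simp add: simple_function_restrict_space[OF An] AE_restrict_space_iff[OF An])
  qed
  then have "\<exists>s. \<forall>n. (\<forall>i::nat. simple_function M (\<lambda>x. indicator (A n) x *\<^sub>R s n i x)) \<and>
          (AE x in M. x \<in> A n \<longrightarrow> (\<lambda>i. s n i x) \<longlonglongrightarrow> f x)"
    by (intro choice allI)
  then obtain s where s: "\<And>n i. simple_function M (\<lambda>x. indicator (A n) x *\<^sub>R s n i x)"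
    and ls: "\<And>n. AE x in M. x \<in> A n \<longrightarrow> (\<lambda>i::nat. s n i x) \<longlonglongrightarrow> f x"
    by blast
  define D where "D = disjointed A"
  have D: "D n \<in> sets M" for n
  proof -
    have "range A \<subseteq> sets M" using A by (rule image_subsetI)
    from sets.range_disjointed_sets[OF this] show ?thesis
      unfolding D_def by (rule subsetD) (rule rangeI)
  qed
  have DA: "D n \<subseteq> A n" for n unfolding D_def by (rule disjointed_subset)
  define t where "t i x = (\<Sum>n<i. indicator (D n) x *\<^sub>R (indicator (A n) x *\<^sub>R s n i x))" for i x
  have "simple_function M (t i)" for i
    unfolding t_def
    by (intro simple_function_sum simple_function_compose2[where h="\<lambda>a. scaleR a"] s simple_function_indicator D)
  moreover have "AE x in M. (\<lambda>i. t i x) \<longlonglongrightarrow> f x"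
  proof -
    have "AE x in M. \<forall>n. x \<in> A n \<longrightarrow> (\<lambda>i::nat. s n i x) \<longlonglongrightarrow> f x"
      by (rule AE_all_countable[THEN iffD2, rule_format]) (rule ls)
    with AE_space[of M] show ?thesis
    proof eventually_elim
      case (elim x)
      then have "x \<in> (\<Union>n. D n)" using cover unfolding D_def by (auto simp: UN_disjointed_eq)
      then obtain n where n: "x \<in> D n" by blast
      have other: "x \<notin> D k" if "k \<noteq> n" for k
        using disjoint_family_disjointed[of A] n that unfolding disjoint_family_on_def D_def by blast
      have "t i x = s n i x" if "i > n" for i
      proof -
        have "t i x = (\<Sum>k<i. if k = n then s n i x else 0)"
          unfolding t_def using n DA[of n] other by (intro sum.cong) (auto simp: indicator_def)
        then show ?thesis using that by simp
      qed
      then have "eventually (\<lambda>i. s n i x = t i x) sequentially"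
        by (intro eventually_sequentiallyI[of "Suc n"]) auto
      moreover have "(\<lambda>i. s n i x) \<longlonglongrightarrow> f x" using elim n DA by blast
      ultimately show ?case by (rule Lim_transform_eventually[rotated])
    qed
  qed
  ultimately show ?thesis unfolding strongly_measurable_def by blast
qed

lemma strongly_measurable_extend:
  assumes f: "strongly_measurable (restrict_space M S) f" and S: "S \<in> sets M"
  shows "strongly_measurable M (\<lambda>x. if x \<in> S then f x else 0)"
proof -
  have S': "S \<inter> space M \<in> sets M" using S by auto
  obtain s where s: "\<And>i::nat. simple_function M (\<lambda>x. indicator S x *\<^sub>R s i x)"
    and ls: "AE x in M. x \<in> S \<longrightarrow> (\<lambda>i. s i x) \<longlonglongrightarrow> f x"
    using f unfolding strongly_measurable_def
    by (auto simp: simple_function_restrict_space[OF S'] AE_restrict_space_iff[OF S'])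
  have "AE x in M. (\<lambda>i. indicator S x *\<^sub>R s i x) \<longlonglongrightarrow> (if x \<in> S then f x else 0)"
    using ls by eventually_elim (auto simp: indicator_def)
  with s show ?thesis unfolding strongly_measurable_def by (intro exI[of _ "\<lambda>i x. indicator S x *\<^sub>R s i x"]) blast
qed

text \<open>The condition \<open>distr M N T = N\<close> makes preimages of null sets null, which is what carries the
  almost everywhere convergence over.\<close>

lemma strongly_measurable_compose:
  assumes T: "T \<in> measurable M N" and d: "distr M N T = N" and f: "strongly_measurable N f"
  shows "strongly_measurable M (\<lambda>x. f (T x))"
proof -
  obtain s where s: "\<And>i::nat. simple_function N (s i)" and ls: "AE x in N. (\<lambda>i. s i x) \<longlonglongrightarrow> f x"
    using f unfolding strongly_measurable_def by blast
  have "simple_function M (\<lambda>x. s i (T x))" for i by (rule simple_function_comp[OF T s])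
  moreover have "AE x in M. (\<lambda>i. s i (T x)) \<longlonglongrightarrow> f (T x)"
    by (rule AE_distrD[OF T, unfolded d, OF ls])
  ultimately show ?thesis unfolding strongly_measurable_def by (intro exI[of _ "\<lambda>i x. s i (T x)"]) blast
qed

lemma complete_measure_restrict_space:
  assumes M: "complete_measure M" and S: "S \<in> sets M"
  shows "complete_measure (restrict_space M S)"
proof (rule complete_measure.intro)
  fix A B assume BA: "B \<subseteq> A" and A: "A \<in> null_sets (restrict_space M S)"
  have A': "A \<subseteq> S \<and> A \<in> null_sets M"
    by (rule null_sets_restrict_space[OF S, THEN iffD1, OF A])
  have "B \<in> sets M" by (rule complete_measure.complete[OF M BA]) (use A' in simp)
  moreover have "B \<subseteq> S" using A' BA by auto
  ultimately show "B \<in> sets (restrict_space M S)"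
    using sets_restrict_space_iff[of S M B] S by simp
qed

lemma complete_lebesgue_on:
  "S \<in> sets lebesgue \<Longrightarrow> complete_measure (lebesgue_on S)"
  by (rule complete_measure_restrict_space[OF completion.complete_measure_axioms])

text \<open>Completeness of the measure is what turns convergence off a null set into honest
  measurability; the norm is the pointwise limit of simple functions after both are set to
  \<open>0\<close> on the exceptional null set.\<close>

lemma borel_measurable_norm_strongly_measurable:
  assumes "complete_measure M" and f: "strongly_measurable M f"
  shows "(\<lambda>x. norm (f x)) \<in> borel_measurable M"
proof -
  interpret complete_measure M by fact
  obtain s where s: "\<And>i::nat. simple_function M (s i)" and ls: "AE x in M. (\<lambda>i. s i x) \<longlonglongrightarrow> f x"
    using f unfolding strongly_measurable_def by blast
  then obtain N where N: "N \<in> null_sets M" "{x\<in>space M. \<not> (\<lambda>i. s i x) \<longlonglongrightarrow> f x} \<subseteq> N"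
    by (auto elim!: AE_E intro: null_setsI)
  define g where "g x = (if x \<in> N then 0 else norm (f x))" for x
  have [measurable]: "(\<lambda>x. norm (s i x)) \<in> borel_measurable M" for i
    by (rule borel_measurable_simple_function[OF simple_function_compose1[OF s]])
  have [measurable]: "N \<in> sets M" using N by blast
  have "g \<in> borel_measurable M"
  proof (rule borel_measurable_LIMSEQ_real[where u="\<lambda>i x. if x \<in> N then 0 else norm (s i x)"])
    show "(\<lambda>i. if x \<in> N then 0 else norm (s i x)) \<longlonglongrightarrow> g x" if "x \<in> space M" for x
      using N(2) that by (auto simp: g_def intro!: tendsto_norm)
  qed measurable
  then have g: "{x\<in>space M. a < g x} \<in> sets M" for a by measurable
  show ?thesis
  proof (subst borel_measurable_iff_greater, intro allI)
    fix a
    have "AE x in M. (x \<in> {x\<in>space M. a < g x}) \<longleftrightarrow> (x \<in> {x\<in>space M. a < norm (f x)})"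
      using AE_not_in[OF N(1)] by eventually_elim (simp add: g_def)
    from in_sets_AE[OF this g] show "{w \<in> space M. a < norm (f w)} \<in> sets M" by auto
  qed
qed

section \<open>The Bochner integral\<close>

abbreviation "sb_integrable \<equiv> Bochner_Integration.simple_bochner_integrable"
abbreviation "sb_integral \<equiv> Bochner_Integration.simple_bochner_integral"

lemma sb_simple: "sb_integrable M s \<Longrightarrow> simple_function M s"
  by (auto elim: simple_bochner_integrable.cases)

lemma sb_integral_norm_le_nn_integral:
  assumes "sb_integrable M s"
  shows "ennreal (norm (sb_integral M s)) \<le> (\<integral>\<^sup>+x. ennreal (norm (s x)) \<partial>M)"
proof -
  have n: "sb_integrable M (\<lambda>x. norm (s x))"
    using simple_bochner_integrable_compose2[of "\<lambda>x y. norm x", OF _ assms assms] by simp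
  show ?thesis
    using simple_bochner_integral_norm_bound[OF assms] simple_bochner_integral_eq_nn_integral[OF n]
    by (metis ennreal_leI norm_ge_zero)
qed

lemma borel_measurable_norm_diff_simple:
  assumes "complete_measure M" "strongly_measurable M f" "simple_function M s"
  shows "(\<lambda>x. norm (f x - s x)) \<in> borel_measurable M"
proof -
  have "strongly_measurable M s"
    unfolding strongly_measurable_def by (rule exI[of _ "\<lambda>_. s"]) (use assms in auto)
  then show ?thesis
    using assms by (intro borel_measurable_norm_strongly_measurable strongly_measurable_diff)
qed

lemma has_bochner_norm_le:
  assumes M: "complete_measure M" and f: "has_bochner M f y"
  shows "ennreal (norm y) \<le> (\<integral>\<^sup>+x. ennreal (norm (f x)) \<partial>M)"
proof -
  from f obtain s where sm: "strongly_measurable M f" and s: "\<And>i. sb_integrable M (s i)"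
    and l: "(\<lambda>i. \<integral>\<^sup>+x. ennreal (norm (f x - s i x)) \<partial>M) \<longlonglongrightarrow> 0"
    and y: "(\<lambda>i. sb_integral M (s i)) \<longlonglongrightarrow> y"
    unfolding has_bochner_def by blast
  note [measurable] = borel_measurable_norm_strongly_measurable[OF M sm]
    borel_measurable_norm_diff_simple[OF M sm sb_simple[OF s]]
  have "ennreal (norm (sb_integral M (s i))) \<le>
      (\<integral>\<^sup>+x. ennreal (norm (f x)) \<partial>M) + (\<integral>\<^sup>+x. ennreal (norm (f x - s i x)) \<partial>M)" for i
  proof -
    have "(\<integral>\<^sup>+x. ennreal (norm (s i x)) \<partial>M) \<le>
        (\<integral>\<^sup>+x. ennreal (norm (f x)) + ennreal (norm (f x - s i x)) \<partial>M)"
    proof (intro nn_integral_mono)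
      fix x
      have "norm (s i x) \<le> norm (f x) + norm (f x - s i x)"
        by (metis add.commute norm_minus_commute norm_triangle_sub)
      then show "ennreal (norm (s i x)) \<le> ennreal (norm (f x)) + ennreal (norm (f x - s i x))"
        by (simp flip: ennreal_plus)
    qed
    also have "\<dots> = (\<integral>\<^sup>+x. ennreal (norm (f x)) \<partial>M) + (\<integral>\<^sup>+x. ennreal (norm (f x - s i x)) \<partial>M)"
      by (rule nn_integral_add) measurable
    finally show ?thesis using sb_integral_norm_le_nn_integral[OF s[of i]] by (rule order_trans[rotated])
  qed
  moreover have "(\<lambda>i. ennreal (norm (sb_integral M (s i)))) \<longlonglongrightarrow> ennreal (norm y)"
    by (intro tendsto_ennrealI tendsto_norm y)
  moreover have "(\<lambda>i. (\<integral>\<^sup>+x. ennreal (norm (f x)) \<partial>M) + (\<integral>\<^sup>+x. ennreal (norm (f x - s i x)) \<partial>M))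
      \<longlonglongrightarrow> (\<integral>\<^sup>+x. ennreal (norm (f x)) \<partial>M) + 0"
    by (intro tendsto_add tendsto_const l)
  ultimately show ?thesis using LIMSEQ_le by fastforce
qed

lemma has_bochner_diff:
  assumes M: "complete_measure M" and f: "has_bochner M f y" and g: "has_bochner M g z"
  shows "has_bochner M (\<lambda>x. f x - g x) (y - z)"
proof -
  from f obtain s where fm: "strongly_measurable M f" and s: "\<And>i. sb_integrable M (s i)"
    and ls: "(\<lambda>i. \<integral>\<^sup>+x. ennreal (norm (f x - s i x)) \<partial>M) \<longlonglongrightarrow> 0"
    and y: "(\<lambda>i. sb_integral M (s i)) \<longlonglongrightarrow> y"
    unfolding has_bochner_def by blast
  from g obtain r where gm: "strongly_measurable M g" and r: "\<And>i. sb_integrable M (r i)"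
    and lr: "(\<lambda>i. \<integral>\<^sup>+x. ennreal (norm (g x - r i x)) \<partial>M) \<longlonglongrightarrow> 0"
    and z: "(\<lambda>i. sb_integral M (r i)) \<longlonglongrightarrow> z"
    unfolding has_bochner_def by blast
  note [measurable] = borel_measurable_norm_diff_simple[OF M fm sb_simple[OF s]]
    borel_measurable_norm_diff_simple[OF M gm sb_simple[OF r]]
  have "(\<lambda>i. \<integral>\<^sup>+x. ennreal (norm (f x - g x - (s i x - r i x))) \<partial>M) \<longlonglongrightarrow> 0"
  proof (rule tendsto_sandwich[OF _ _ tendsto_const])
    show "\<forall>\<^sub>F i in sequentially. (\<integral>\<^sup>+x. ennreal (norm (f x - g x - (s i x - r i x))) \<partial>M)
      \<le> (\<integral>\<^sup>+x. ennreal (norm (f x - s i x)) \<partial>M) + (\<integral>\<^sup>+x. ennreal (norm (g x - r i x)) \<partial>M)"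
    proof (rule always_eventually, rule allI)
      fix i
      have "(\<integral>\<^sup>+x. ennreal (norm (f x - g x - (s i x - r i x))) \<partial>M)
        \<le> (\<integral>\<^sup>+x. ennreal (norm (f x - s i x)) + ennreal (norm (g x - r i x)) \<partial>M)"
      proof (rule nn_integral_mono)
        fix x
        have "f x - g x - (s i x - r i x) = (f x - s i x) - (g x - r i x)" by simp
        then have "norm (f x - g x - (s i x - r i x)) \<le> norm (f x - s i x) + norm (g x - r i x)"
          by (metis norm_triangle_ineq4)
        then show "ennreal (norm (f x - g x - (s i x - r i x))) \<le> ennreal (norm (f x - s i x)) + ennreal (norm (g x - r i x))"
          by (simp flip: ennreal_plus)
      qed
      then show "(\<integral>\<^sup>+x. ennreal (norm (f x - g x - (s i x - r i x))) \<partial>M)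
        \<le> (\<integral>\<^sup>+x. ennreal (norm (f x - s i x)) \<partial>M) + (\<integral>\<^sup>+x. ennreal (norm (g x - r i x)) \<partial>M)"
        by (subst (asm) nn_integral_add) measurable
    qed
    show "(\<lambda>i. (\<integral>\<^sup>+x. ennreal (norm (f x - s i x)) \<partial>M) + (\<integral>\<^sup>+x. ennreal (norm (g x - r i x)) \<partial>M)) \<longlonglongrightarrow> 0"
      using tendsto_add[OF ls lr] by simp
  qed auto
  moreover have "(\<lambda>i. sb_integral M (\<lambda>x. s i x - r i x)) \<longlonglongrightarrow> y - z"
    using tendsto_diff[OF y z] by (simp add: simple_bochner_integral_diff s r)
  moreover have "sb_integrable M (\<lambda>x. s i x - r i x)" for i
    by (rule simple_bochner_integrable_compose2[OF _ s r]) simp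
  ultimately show ?thesis unfolding has_bochner_def
    using strongly_measurable_diff[OF fm gm] by (intro conjI exI[of _ "\<lambda>i x. s i x - r i x"]) auto
qed

lemma has_bochner_unique:
  assumes "complete_measure M" "has_bochner M f y" "has_bochner M f z"
  shows "y = z"
  using has_bochner_norm_le[OF assms(1) has_bochner_diff[OF assms]] by simp

lemma bochner_integral_eq:
  assumes "complete_measure M" "has_bochner M f y"
  shows "bochner_integral M f = y"
  unfolding bochner_integral_def using assms has_bochner_unique by (intro the_equality) blast+

lemma has_bochner_AE_cong:
  assumes f: "has_bochner M f y" and eq: "AE x in M. f x = g x"
  shows "has_bochner M g y"
proof -
  have "(\<integral>\<^sup>+x. ennreal (norm (f x - s x)) \<partial>M) = (\<integral>\<^sup>+x. ennreal (norm (g x - s x)) \<partial>M)" for s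
    by (rule nn_integral_cong_AE) (use eq in \<open>eventually_elim; simp\<close>)
  then show ?thesis
    using f strongly_measurable_AE_cong[OF _ eq] unfolding has_bochner_def by auto
qed

lemma has_bochner_bounded_linear:
  assumes M: "complete_measure M" and f: "has_bochner M f y" and T: "bounded_linear T"
  shows "has_bochner M (\<lambda>x. T (f x)) (T y)"
proof -
  interpret T: bounded_linear T by fact
  from f obtain s where fm: "strongly_measurable M f" and s: "\<And>i. sb_integrable M (s i)"
    and ls: "(\<lambda>i. \<integral>\<^sup>+x. ennreal (norm (f x - s i x)) \<partial>M) \<longlonglongrightarrow> 0"
    and y: "(\<lambda>i. sb_integral M (s i)) \<longlonglongrightarrow> y"
    unfolding has_bochner_def by blast
  obtain K where K: "0 \<le> K" "\<And>x. norm (T x) \<le> norm x * K" using T.nonneg_bounded by blast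
  note [measurable] = borel_measurable_norm_diff_simple[OF M fm sb_simple[OF s]]
  have "(\<lambda>i. \<integral>\<^sup>+x. ennreal (norm (T (f x) - T (s i x))) \<partial>M) \<longlonglongrightarrow> 0"
  proof (rule tendsto_sandwich[OF _ _ tendsto_const])
    show "\<forall>\<^sub>F i in sequentially. (\<integral>\<^sup>+x. ennreal (norm (T (f x) - T (s i x))) \<partial>M)
      \<le> ennreal K * (\<integral>\<^sup>+x. ennreal (norm (f x - s i x)) \<partial>M)"
    proof (rule always_eventually, rule allI)
      fix i
      have "(\<integral>\<^sup>+x. ennreal (norm (T (f x) - T (s i x))) \<partial>M)
        \<le> (\<integral>\<^sup>+x. ennreal K * ennreal (norm (f x - s i x)) \<partial>M)"
        using K by (intro nn_integral_mono) (simp flip: T.diff ennreal_mult add: mult.commute)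
      then show "(\<integral>\<^sup>+x. ennreal (norm (T (f x) - T (s i x))) \<partial>M)
        \<le> ennreal K * (\<integral>\<^sup>+x. ennreal (norm (f x - s i x)) \<partial>M)"
        by (subst (asm) nn_integral_cmult) measurable
    qed
    show "(\<lambda>i. ennreal K * (\<integral>\<^sup>+x. ennreal (norm (f x - s i x)) \<partial>M)) \<longlonglongrightarrow> 0"
      using ennreal_tendsto_cmult[OF _ ls, of "ennreal K"] by simp
  qed auto
  moreover have "(\<lambda>i. sb_integral M (\<lambda>x. T (s i x))) \<longlonglongrightarrow> T y"
    using T.tendsto[OF y] by (simp add: simple_bochner_integral_linear[OF T.linear_axioms s])
  moreover have "sb_integrable M (\<lambda>x. T (s i x))" for i
    using simple_bochner_integrable_compose2[of "\<lambda>x y. T x", OF _ s s] by (simp add: T.zero)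
  moreover have "strongly_measurable M (\<lambda>x. T (f x))"
    by (rule strongly_measurable_continuous2[OF fm fm, where T="\<lambda>x y. T x"]) (intro T.continuous_on continuous_intros)
  ultimately show ?thesis unfolding has_bochner_def
    by (intro conjI exI[of _ "\<lambda>i x. T (s i x)"]) auto
qed

text \<open>The usual criterion of absolute integrability. The approximants of a strongly measurable
  function need not be integrable, hence they are replaced by \<open>0\<close> where their norm exceeds
  twice the norm of the limit; this keeps pointwise convergence and provides the majorant
  \<open>3 \<parallel>f\<parallel>\<close>. Completeness of the target space then gives the limit of the integrals.\<close>

lemma has_bochner_exists:
  fixes f :: "'a \<Rightarrow> 'b::banach"
  assumes M: "complete_measure M" and f: "strongly_measurable M f"
    and fin: "(\<integral>\<^sup>+x. ennreal (norm (f x)) \<partial>M) < \<infinity>"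
  shows "\<exists>y. has_bochner M f y"
proof -
  obtain s where s: "\<And>i::nat. simple_function M (s i)" and ls: "AE x in M. (\<lambda>i. s i x) \<longlonglongrightarrow> f x"
    using f unfolding strongly_measurable_def by blast
  note fm[measurable] = borel_measurable_norm_strongly_measurable[OF M f]
  have sm[measurable]: "(\<lambda>x. norm (s i x)) \<in> borel_measurable M" for i
    by (rule borel_measurable_simple_function[OF simple_function_compose1[OF s]])
  define t where "t i x = (if norm (s i x) \<le> 2 * norm (f x) then s i x else 0)" for i x
  have t: "simple_function M (t i)" for i
    unfolding t_def by (rule simple_function_If[OF s simple_function_const]) measurable
  have tb: "norm (t i x) \<le> 2 * norm (f x)" for i x by (simp add: t_def)
  have lt: "AE x in M. (\<lambda>i. t i x) \<longlonglongrightarrow> f x"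
    using ls
  proof eventually_elim
    case (elim x)
    show ?case
    proof (cases "f x = 0")
      case True
      then have "t i x = 0" for i by (simp add: t_def)
      with True show ?thesis by simp
    next
      case False
      then have "norm (f x) < 2 * norm (f x)" by simp
      from order_tendstoD(2)[OF tendsto_norm[OF elim] this]
      have "\<forall>\<^sub>F i in sequentially. s i x = t i x"
        by eventually_elim (simp add: t_def)
      then show ?thesis by (rule Lim_transform_eventually[OF elim])
    qed
  qed
  have int2: "(\<integral>\<^sup>+x. ennreal (c * norm (f x)) \<partial>M) < \<infinity>" if "c \<ge> 0" for c
    using fin that by (simp add: ennreal_mult nn_integral_cmult ennreal_mult_less_top)
  have tI: "sb_integrable M (t i)" for i
  proof (rule simple_bochner_integrableI_bounded[OF t])
    have "(\<integral>\<^sup>+x. ennreal (norm (t i x)) \<partial>M) \<le> (\<integral>\<^sup>+x. ennreal (2 * norm (f x)) \<partial>M)"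
      by (intro nn_integral_mono ennreal_leI tb)
    with int2[of 2] show "(\<integral>\<^sup>+x. ennreal (norm (t i x)) \<partial>M) < \<infinity>" by (simp add: le_less_trans)
  qed
  note tm[measurable] = borel_measurable_norm_diff_simple[OF M f t]
  have lim: "(\<lambda>i. \<integral>\<^sup>+x. ennreal (norm (f x - t i x)) \<partial>M) \<longlonglongrightarrow> (\<integral>\<^sup>+x. 0 \<partial>M)"
  proof (rule nn_integral_dominated_convergence[where w="\<lambda>x. ennreal (3 * norm (f x))"])
    show "AE x in M. ennreal (norm (f x - t i x)) \<le> ennreal (3 * norm (f x))" for i
    proof (rule AE_I2, rule ennreal_leI)
      fix x show "norm (f x - t i x) \<le> 3 * norm (f x)"
        using norm_triangle_ineq4[of "f x" "t i x"] tb[of i x] by simp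
    qed
    show "AE x in M. (\<lambda>i. ennreal (norm (f x - t i x))) \<longlonglongrightarrow> 0"
      using lt
    proof eventually_elim
      case (elim x)
      have "(\<lambda>i. norm (f x - t i x)) \<longlonglongrightarrow> 0"
        using tendsto_norm[OF tendsto_diff[OF tendsto_const elim, of "f x"]] by simp
      then show ?case using tendsto_ennrealI by fastforce
    qed
    show "(\<integral>\<^sup>+x. ennreal (3 * norm (f x)) \<partial>M) < \<infinity>" by (rule int2) simp
  qed measurable
  then have lim: "(\<lambda>i. \<integral>\<^sup>+x. ennreal (norm (f x - t i x)) \<partial>M) \<longlonglongrightarrow> 0" by simp
  have est: "ennreal (norm (sb_integral M (t i) - sb_integral M (t j))) \<le>
      (\<integral>\<^sup>+x. ennreal (norm (f x - t i x)) \<partial>M) + (\<integral>\<^sup>+x. ennreal (norm (f x - t j x)) \<partial>M)" for i j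
  proof -
    have "ennreal (norm (sb_integral M (t i) - sb_integral M (t j))) =
        ennreal (norm (sb_integral M (\<lambda>x. t i x - t j x)))"
      by (simp add: simple_bochner_integral_diff tI)
    also have "\<dots> \<le> (\<integral>\<^sup>+x. ennreal (norm (t i x - t j x)) \<partial>M)"
      by (intro sb_integral_norm_le_nn_integral simple_bochner_integrable_compose2[OF _ tI tI]) simp
    also have "\<dots> \<le> (\<integral>\<^sup>+x. ennreal (norm (f x - t i x)) + ennreal (norm (f x - t j x)) \<partial>M)"
    proof (intro nn_integral_mono)
      fix x
      have "norm (t i x - t j x) \<le> norm (f x - t i x) + norm (f x - t j x)"
        by (metis dual_order.refl norm_diff_triangle_le norm_minus_commute)
      then show "ennreal (norm (t i x - t j x)) \<le> ennreal (norm (f x - t i x)) + ennreal (norm (f x - t j x))"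
        by (simp flip: ennreal_plus)
    qed
    also have "\<dots> = (\<integral>\<^sup>+x. ennreal (norm (f x - t i x)) \<partial>M) + (\<integral>\<^sup>+x. ennreal (norm (f x - t j x)) \<partial>M)"
      by (rule nn_integral_add) measurable
    finally show ?thesis .
  qed
  have "Cauchy (\<lambda>i. sb_integral M (t i))"
  proof (rule metric_CauchyI)
    fix e :: real assume e: "0 < e"
    then have "\<forall>\<^sub>F i in sequentially. (\<integral>\<^sup>+x. ennreal (norm (f x - t i x)) \<partial>M) < ennreal (e / 2)"
      by (intro order_tendstoD(2)[OF lim]) simp
    then obtain n where n: "\<And>i. i \<ge> n \<Longrightarrow> (\<integral>\<^sup>+x. ennreal (norm (f x - t i x)) \<partial>M) < ennreal (e / 2)"
      by (auto simp: eventually_sequentially)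
    show "\<exists>n. \<forall>i\<ge>n. \<forall>j\<ge>n. dist (sb_integral M (t i)) (sb_integral M (t j)) < e"
    proof (intro exI[of _ n] allI impI)
      fix i j assume "n \<le> i" "n \<le> j"
      have "ennreal (norm (sb_integral M (t i) - sb_integral M (t j))) < ennreal (e/2) + ennreal (e/2)"
        using est[of i j] n[OF \<open>n \<le> i\<close>] n[OF \<open>n \<le> j\<close>] by (meson add_strict_mono le_less_trans)
      also have "\<dots> = ennreal e" using e by (simp flip: ennreal_plus)
      finally show "dist (sb_integral M (t i)) (sb_integral M (t j)) < e"
        using e by (simp add: dist_norm ennreal_less_iff)
    qed
  qed
  then obtain y where "(\<lambda>i. sb_integral M (t i)) \<longlonglongrightarrow> y"
    using Cauchy_convergent convergent_def by blast
  then show ?thesis unfolding has_bochner_def using f tI lim by blast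
qed

lemma has_bochner_extend:
  assumes M: "complete_measure M" and S: "S \<in> sets M" and f: "has_bochner (restrict_space M S) f y"
    and f0: "\<And>x. x \<in> space M - S \<Longrightarrow> f x = 0"
  shows "has_bochner M f y"
proof -
  have S': "S \<inter> space M \<in> sets M" using S by auto
  from f obtain s where fm: "strongly_measurable (restrict_space M S) f"
    and s: "\<And>i. sb_integrable (restrict_space M S) (s i)"
    and ls: "(\<lambda>i. \<integral>\<^sup>+x. ennreal (norm (f x - s i x)) \<partial>restrict_space M S) \<longlonglongrightarrow> 0"
    and y: "(\<lambda>i. sb_integral (restrict_space M S) (s i)) \<longlonglongrightarrow> y"
    unfolding has_bochner_def by blast
  have "(\<integral>\<^sup>+x. ennreal (norm (f x - s i x)) \<partial>restrict_space M S) =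
      (\<integral>\<^sup>+x. ennreal (norm (f x - indicator S x *\<^sub>R s i x)) \<partial>M)" for i
    unfolding nn_integral_restrict_space[OF S']
    by (intro nn_integral_cong) (use f0 in \<open>auto simp: indicator_def\<close>)
  moreover have "sb_integrable M (\<lambda>x. indicator S x *\<^sub>R s i x)" for i
    using s[of i] simple_bochner_integrable_restrict_space[OF S'] by blast
  moreover have "strongly_measurable M f"
    by (rule strongly_measurable_AE_cong[OF strongly_measurable_extend[OF fm S]])
      (use f0 in \<open>auto intro!: AE_I2\<close>)
  ultimately show ?thesis unfolding has_bochner_def
    using ls y simple_bochner_integral_restrict_space[OF S' s]
    by (intro conjI exI[of _ "\<lambda>i x. indicator S x *\<^sub>R s i x"]) auto
qed

text \<open>The restricted integral exists by absolute integrability, and extending it by zero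
  identifies its value through uniqueness. This avoids modifying the approximants of \<open>f\<close>.\<close>

lemma has_bochner_restrict:
  fixes f :: "'a \<Rightarrow> 'b::banach"
  assumes M: "complete_measure M" and S: "S \<in> sets M" and f: "has_bochner M f y"
    and fin: "(\<integral>\<^sup>+x. ennreal (norm (f x)) \<partial>M) < \<infinity>"
    and f0: "\<And>x. x \<in> space M - S \<Longrightarrow> f x = 0"
  shows "has_bochner (restrict_space M S) f y"
proof -
  have S': "S \<inter> space M \<in> sets M" using S by auto
  have "(\<integral>\<^sup>+x. ennreal (norm (f x)) \<partial>restrict_space M S) \<le> (\<integral>\<^sup>+x. ennreal (norm (f x)) \<partial>M)"
    unfolding nn_integral_restrict_space[OF S'] by (intro nn_integral_mono) (auto simp: indicator_def)
  then have "\<exists>z. has_bochner (restrict_space M S) f z"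
    using fin f unfolding has_bochner_def[of M]
    by (intro has_bochner_exists complete_measure_restrict_space[OF M S] strongly_measurable_restrict[OF _ S']) auto
  then obtain z where z: "has_bochner (restrict_space M S) f z" ..
  with has_bochner_extend[OF M S z f0] f M has_bochner_unique show ?thesis by metis
qed

text \<open>Change of variables for a measure preserving surjection. Surjectivity lets the simple
  integrals on both sides range over the same finite set of values.\<close>

lemma has_bochner_compose:
  assumes T: "T \<in> measurable M N" and d: "distr M N T = N" and on: "T ` space M = space N"
    and N: "complete_measure N" and f: "has_bochner N f y"
  shows "has_bochner M (\<lambda>x. f (T x)) y"
proof -
  from f obtain s where fm: "strongly_measurable N f" and s: "\<And>i. sb_integrable N (s i)"
    and ls: "(\<lambda>i. \<integral>\<^sup>+x. ennreal (norm (f x - s i x)) \<partial>N) \<longlonglongrightarrow> 0"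
    and y: "(\<lambda>i. sb_integral N (s i)) \<longlonglongrightarrow> y"
    unfolding has_bochner_def by blast
  note [measurable] = borel_measurable_norm_diff_simple[OF N fm sb_simple[OF s]]
  have "(\<integral>\<^sup>+x. ennreal (norm (f (T x) - s i (T x))) \<partial>M) = (\<integral>\<^sup>+x. ennreal (norm (f x - s i x)) \<partial>N)" for i
    using nn_integral_distr[OF T, of "\<lambda>x. ennreal (norm (f x - s i x))"] d by simp
  moreover have em: "emeasure N A = emeasure M (T -` A \<inter> space M)" if "A \<in> sets N" for A
    using emeasure_distr[OF T that] d by simp
  have lev: "{x\<in>space N. P (s i x)} \<in> sets N" for P i
    using measurable_sets[OF measurable_simple_function[OF sb_simple[OF s[of i]]], of "{x. P x}"]
    by (simp add: vimage_def Int_def conj_commute)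
  have lev2: "emeasure M {x\<in>space M. P (s i (T x))} = emeasure N {x\<in>space N. P (s i x)}" for P i
  proof -
    have "T -` {x\<in>space N. P (s i x)} \<inter> space M = {x\<in>space M. P (s i (T x))}"
      using measurable_space[OF T] by auto
    then show ?thesis using em[OF lev[of P i]] by simp
  qed
  moreover have "sb_integrable M (\<lambda>x. s i (T x))" for i
    using s[of i] by (auto simp: simple_bochner_integrable.simps lev2[of "\<lambda>z. z \<noteq> 0"] intro: simple_function_comp[OF T])
  moreover have "sb_integral M (\<lambda>x. s i (T x)) = sb_integral N (s i)" for i
  proof -
    have "(\<lambda>x. s i (T x)) ` space M = s i ` space N" using on by (metis image_image)
    then show ?thesis
      unfolding simple_bochner_integral_def using lev2[of "\<lambda>z. z = y" i for y]
      by (simp add: measure_def)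
  qed
  ultimately show ?thesis unfolding has_bochner_def
    using ls y strongly_measurable_compose[OF T d fm]
    by (intro conjI exI[of _ "\<lambda>i x. s i (T x)"]) auto
qed

section \<open>Lebesgue norms\<close>

lemma ennreal_powr_ennreal: "x \<ge> 0 \<Longrightarrow> ennreal_powr (ennreal x) p = ennreal (x powr p)"
  by (simp add: ennreal_powr_def)

lemma eLp_norm_real:
  assumes "1 \<le> q"
  shows "eLp_norm (ennreal q) M f = ennreal_powr (\<integral>\<^sup>+x. ennreal (norm (f x) powr q) \<partial>M) (1 / q)"
  using assms by (simp add: eLp_norm_def)

lemma eLp_norm_le_iff:
  assumes q: "1 \<le> q" and c: "0 \<le> c"
  shows "eLp_norm (ennreal q) M f \<le> ennreal c \<longleftrightarrow>
    (\<integral>\<^sup>+x. ennreal (norm (f x) powr q) \<partial>M) \<le> ennreal (c powr q)"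
proof (cases "\<integral>\<^sup>+x. ennreal (norm (f x) powr q) \<partial>M")
  case (real a)
  have "a powr (1/q) \<le> c \<longleftrightarrow> a \<le> c powr q"
  proof
    assume "a powr (1/q) \<le> c"
    then have "(a powr (1/q)) powr q \<le> c powr q" using q by (intro powr_mono2) auto
    then show "a \<le> c powr q" using q real by (simp add: powr_powr)
  next
    assume "a \<le> c powr q"
    then have "a powr (1/q) \<le> (c powr q) powr (1/q)" using q real by (intro powr_mono2) auto
    then show "a powr (1/q) \<le> c" using q c by (simp add: powr_powr)
  qed
  with real c show ?thesis by (simp add: eLp_norm_real[OF q] ennreal_powr_ennreal)
next
  case top
  then show ?thesis by (simp add: eLp_norm_real[OF q] ennreal_powr_def top_unique)
qed

lemma nn_integral_powr_eq_eLp_norm: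
  assumes q: "1 \<le> q" and "eLp_norm (ennreal q) M f = ennreal c" "0 \<le> c"
  shows "(\<integral>\<^sup>+x. ennreal (norm (f x) powr q) \<partial>M) = ennreal (c powr q)"
proof (cases "\<integral>\<^sup>+x. ennreal (norm (f x) powr q) \<partial>M")
  case (real a)
  then have "c = a powr (1/q)" using assms by (simp add: eLp_norm_real ennreal_powr_ennreal)
  then show ?thesis using real q by (simp add: powr_powr)
next
  case top
  then show ?thesis using assms by (simp add: eLp_norm_real[OF q] ennreal_powr_def)
qed

lemma eLp_norm_le_if_nn_integral_le:
  assumes q: "1 \<le> q"
    and le: "(\<integral>\<^sup>+x. ennreal (norm (f x) powr q) \<partial>M) \<le> (\<integral>\<^sup>+x. ennreal (norm (g x) powr q) \<partial>N)"
  shows "eLp_norm (ennreal q) M f \<le> eLp_norm (ennreal q) N g"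
proof (cases "eLp_norm (ennreal q) N g")
  case (real c)
  then show ?thesis
    using le nn_integral_powr_eq_eLp_norm[OF q real(2,1)] by (simp add: eLp_norm_le_iff[OF q])
qed simp

lemma eLp_norm_cong:
  assumes q: "1 \<le> q" and eq: "\<And>x. x \<in> space M \<Longrightarrow> norm (f x) = norm (g x)"
  shows "eLp_norm (ennreal q) M f = eLp_norm (ennreal q) M g"
proof -
  have "(\<integral>\<^sup>+x. ennreal (norm (f x) powr q) \<partial>M) = (\<integral>\<^sup>+x. ennreal (norm (g x) powr q) \<partial>M)"
    by (rule nn_integral_cong) (simp add: eq)
  then show ?thesis by (simp add: eLp_norm_real[OF q])
qed

lemma eLp_norm_le_bound:
  assumes q: "1 \<le> q" and b: "0 \<le> b" and M: "emeasure M (space M) \<le> 1"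
    and f: "\<And>x. x \<in> space M \<Longrightarrow> norm (f x) \<le> b"
  shows "eLp_norm (ennreal q) M f \<le> ennreal b"
proof -
  have "(\<integral>\<^sup>+x. ennreal (norm (f x) powr q) \<partial>M) \<le> (\<integral>\<^sup>+x. ennreal (b powr q) \<partial>M)"
    using f q by (intro nn_integral_mono ennreal_leI powr_mono2) auto
  also have "\<dots> = ennreal (b powr q) * emeasure M (space M)" by simp
  also have "\<dots> \<le> ennreal (b powr q) * 1" by (intro mult_left_mono M) simp
  finally show ?thesis by (simp add: eLp_norm_le_iff[OF q b])
qed

lemma eLp_norm_zero: "1 \<le> q \<Longrightarrow> (\<And>x. x \<in> space M \<Longrightarrow> f x = 0) \<Longrightarrow> eLp_norm (ennreal q) M f = 0"
  using eLp_norm_cong[of q M f "\<lambda>_. 0"] by (simp add: eLp_norm_real ennreal_powr_def)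

text \<open>A triangle inequality with the crude constant \<open>4\<close>. It follows from
  \<open>(x + y)\<^sup>q \<le> 2\<^sup>q (x\<^sup>q + y\<^sup>q)\<close>, and is as good as Minkowski's inequality for questions of
  finiteness and of convergence to \<open>0\<close>.\<close>

lemma eLp_norm_dominated_sum:
  assumes q: "1 \<le> q" and [measurable]: "(\<lambda>x. norm (f x)) \<in> borel_measurable M" "(\<lambda>x. norm (g x)) \<in> borel_measurable M"
    and le: "\<And>x. x \<in> space M \<Longrightarrow> norm (w x) \<le> norm (f x) + norm (g x)"
  shows "eLp_norm (ennreal q) M w \<le> 4 * (eLp_norm (ennreal q) M f + eLp_norm (ennreal q) M g)"
proof (cases "eLp_norm (ennreal q) M f = \<infinity> \<or> eLp_norm (ennreal q) M g = \<infinity>")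
  case True
  then show ?thesis by (auto simp: ennreal_mult_eq_top_iff)
next
  case False
  then obtain a b where a: "eLp_norm (ennreal q) M f = ennreal a" "0 \<le> a"
    and b: "eLp_norm (ennreal q) M g = ennreal b" "0 \<le> b"
    by (metis ennreal_cases infinity_ennreal_def)
  have twice: "(x + y) powr q \<le> 2 powr q * (x powr q + y powr q)" if "0 \<le> x" "0 \<le> y" for x y
  proof -
    have "(x + y) powr q \<le> (2 * max x y) powr q" using that q by (intro powr_mono2) auto
    also have "\<dots> = 2 powr q * max x y powr q" using that by (simp add: powr_mult)
    also have "\<dots> \<le> 2 powr q * (x powr q + y powr q)" by (intro mult_left_mono) (auto simp: max_def)
    finally show ?thesis .
  qed
  have "(\<integral>\<^sup>+x. ennreal (norm (w x) powr q) \<partial>M) \<le>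
      (\<integral>\<^sup>+x. ennreal (2 powr q) * (ennreal (norm (f x) powr q) + ennreal (norm (g x) powr q)) \<partial>M)"
  proof (rule nn_integral_mono)
    fix x assume "x \<in> space M"
    then have "norm (w x) powr q \<le> (norm (f x) + norm (g x)) powr q"
      using q le by (intro powr_mono2) auto
    also note twice[OF norm_ge_zero norm_ge_zero]
    finally show "ennreal (norm (w x) powr q) \<le> ennreal (2 powr q) * (ennreal (norm (f x) powr q) + ennreal (norm (g x) powr q))"
      by (simp flip: ennreal_plus ennreal_mult)
  qed
  also have "\<dots> = ennreal (2 powr q) * ((\<integral>\<^sup>+x. ennreal (norm (f x) powr q) \<partial>M) + (\<integral>\<^sup>+x. ennreal (norm (g x) powr q) \<partial>M))"
    by (simp add: nn_integral_cmult nn_integral_add)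
  also have "\<dots> = ennreal (2 powr q * (a powr q + b powr q))"
    using nn_integral_powr_eq_eLp_norm[OF q a] nn_integral_powr_eq_eLp_norm[OF q b]
    by (simp flip: ennreal_plus ennreal_mult)
  also have "\<dots> \<le> ennreal ((4 * (a + b)) powr q)"
  proof (rule ennreal_leI)
    have "a powr q \<le> (a + b) powr q" "b powr q \<le> (a + b) powr q"
      using a b q by (auto intro!: powr_mono2)
    moreover have "(4 * (a + b)) powr q = 2 powr q * (2 powr q * (a + b) powr q)"
      using a b by (simp add: powr_mult[symmetric] flip: mult.assoc)
    moreover have "2 * (a + b) powr q \<le> 2 powr q * (a + b) powr q"
      using q powr_mono[of 1 q 2] by (intro mult_right_mono) auto
    ultimately show "2 powr q * (a powr q + b powr q) \<le> (4 * (a + b)) powr q" by (simp del: mult_le_cancel_right)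
  qed
  finally have "eLp_norm (ennreal q) M w \<le> ennreal (4 * (a + b))"
    using a b by (subst eLp_norm_le_iff[OF q]) auto
  then show ?thesis using a b by (simp add: ennreal_mult)
qed

text \<open>In \<open>ennreal\<close> one has \<open>1 / 0 = \<infinity>\<close> and \<open>1 / \<infinity> = 0\<close>, so the conjugacy equation already excludes
  \<open>q' = 0\<close> and forces \<open>q' = \<infinity>\<close> exactly for \<open>q = 1\<close>.\<close>

lemma conjugate_exponent_cases:
  assumes q: "1 \<le> q" and q': "1 / q' + 1 / ennreal q = 1"
  obtains "q = 1" "q' = \<infinity>" | p where "1 < p" "1 < q" "q' = ennreal p" "1 / p + 1 / q = 1"
proof (cases q')
  case (real p)
  have p0: "p \<noteq> 0"
  proof
    assume "p = 0"
    then have "1 / q' = top" using real by (simp add: ennreal_divide_zero)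
    with q' show False by simp
  qed
  have "ennreal 1 = 1 / ennreal p + 1 / ennreal q" using q' real by simp
  also have "1 / ennreal p = ennreal (1 / p)" using real p0 by (metis divide_ennreal ennreal_1 less_eq_real_def zero_le_one)
  also have "1 / ennreal q = ennreal (1 / q)" using q by (metis divide_ennreal ennreal_1 less_le_trans zero_le_one zero_less_one)
  also have "ennreal (1 / p) + ennreal (1 / q) = ennreal (1 / p + 1 / q)"
    using real q by (intro ennreal_plus[symmetric]) auto
  finally have eq: "1 / p + 1 / q = 1"
    using real q by (subst (asm) ennreal_inj) auto
  have "1 / p > 0" using real p0 by simp
  then have "1 / q < 1" using eq by linarith
  then have "1 < q" using q by (auto simp: field_simps)
  then have "1 / p < 1" using eq by (smt (verit) divide_pos_pos)
  then have "1 < p" using real p0 by (auto simp: field_simps)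
  show thesis by (rule that(2)) fact+
next
  case top
  have "1 / ennreal q = ennreal (1 / q)" using q by (metis divide_ennreal ennreal_1 less_le_trans zero_le_one zero_less_one)
  then have "ennreal (1 / q) = ennreal 1" using q' top by simp
  then have "q = 1" using q by (subst (asm) ennreal_inj) auto
  with top show thesis by (intro that(1)) auto
qed

lemma AE_zero_if_eLp_norm_zero:
  assumes q: "1 \<le> q" and [measurable]: "(\<lambda>x. norm (f x)) \<in> borel_measurable M"
    and 0: "eLp_norm (ennreal q) M f = 0"
  shows "AE x in M. f x = 0"
proof -
  have "(\<integral>\<^sup>+x. ennreal (norm (f x) powr q) \<partial>M) = 0"
    using nn_integral_powr_eq_eLp_norm[OF q, of M f 0] 0 by simp
  then have "AE x in M. ennreal (norm (f x) powr q) = 0" by (subst (asm) nn_integral_0_iff_AE) auto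
  then show ?thesis by eventually_elim simp
qed

text \<open>For \<open>q = 1\<close> the factor \<open>u\<close> is bounded by its essential supremum. Otherwise, when both norms
  \<open>a\<close> and \<open>b\<close> are finite and nonzero, Young's inequality is applied to \<open>\<parallel>u x\<parallel> / a\<close> and
  \<open>\<parallel>v x\<parallel> / b\<close> and integrated. If one norm is \<open>0\<close>, then so is the right-hand side, as \<open>0 * \<infinity> = 0\<close>; the
  integrand then vanishes almost everywhere.\<close>

lemma Hoelder_eLp_norm:
  assumes q: "1 \<le> q" and q': "1 / q' + 1 / ennreal q = 1"
    and [measurable]: "(\<lambda>x. norm (u x)) \<in> borel_measurable M" "(\<lambda>x. norm (v x)) \<in> borel_measurable M"
  shows "(\<integral>\<^sup>+x. ennreal (norm (u x) * norm (v x)) \<partial>M) \<le> eLp_norm q' M u * eLp_norm (ennreal q) M v"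
  using q q'
proof (cases rule: conjugate_exponent_cases)
  case 1
  have v1: "eLp_norm (ennreal q) M v = (\<integral>\<^sup>+x. ennreal (norm (v x)) \<partial>M)"
  proof -
    have "ennreal_powr a 1 = a" for a by (cases a) (auto simp: ennreal_powr_def)
    then show ?thesis using 1 by (simp add: eLp_norm_def)
  qed
  have "(\<integral>\<^sup>+x. ennreal (norm (u x) * norm (v x)) \<partial>M) \<le> (\<integral>\<^sup>+x. eLp_norm q' M u * ennreal (norm (v x)) \<partial>M)"
  proof (rule nn_integral_mono_AE)
    have "AE x in M. ennreal (norm (u x)) \<le> eLp_norm q' M u"
      using esssup_AE[of "\<lambda>x. ennreal (norm (u x))" M] 1 by (simp add: eLp_norm_def)
    then show "AE x in M. ennreal (norm (u x) * norm (v x)) \<le> eLp_norm q' M u * ennreal (norm (v x))"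
      by eventually_elim (simp add: ennreal_mult mult_right_mono)
  qed
  also have "\<dots> = eLp_norm q' M u * eLp_norm (ennreal q) M v"
    unfolding v1 by (rule nn_integral_cmult) measurable
  finally show ?thesis .
next
  case (2 p)
  then have p: "1 \<le> p" by simp
  have zero: ?thesis if "AE x in M. norm (u x) * norm (v x) = 0"
  proof -
    have "(\<integral>\<^sup>+x. ennreal (norm (u x) * norm (v x)) \<partial>M) = 0"
      by (subst nn_integral_0_iff_AE) (use that in \<open>auto elim!: eventually_mono\<close>)
    then show ?thesis by simp
  qed
  show ?thesis
  proof (cases "eLp_norm q' M u = 0 \<or> eLp_norm (ennreal q) M v = 0")
    case True
    then have "AE x in M. norm (u x) * norm (v x) = 0"
    proof
      assume "eLp_norm q' M u = 0"
      then have "AE x in M. u x = 0" by (intro AE_zero_if_eLp_norm_zero[OF p]) (auto simp: 2)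
      then show ?thesis by eventually_elim simp
    next
      assume "eLp_norm (ennreal q) M v = 0"
      then have "AE x in M. v x = 0" by (intro AE_zero_if_eLp_norm_zero[OF q]) auto
      then show ?thesis by eventually_elim simp
    qed
    then show ?thesis by (rule zero)
  next
    case nz: False
    show ?thesis
    proof (cases "eLp_norm q' M u = \<infinity> \<or> eLp_norm (ennreal q) M v = \<infinity>")
      case True
      then have "eLp_norm q' M u * eLp_norm (ennreal q) M v = top"
        using nz by (auto simp: ennreal_mult_eq_top_iff)
      then show ?thesis by simp
    next
      case False
      then obtain a b where a: "eLp_norm q' M u = ennreal a" "0 \<le> a"
        and b: "eLp_norm (ennreal q) M v = ennreal b" "0 \<le> b"
        by (metis ennreal_cases infinity_ennreal_def)
      with nz have ab: "0 < a" "0 < b" by (auto simp: less_le)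
      \<comment> \<open>The coefficients of Young's inequality for the normalised functions, multiplied by \<open>a b\<close>.\<close>
      define c where "c = a * b / (p * a powr p)"
      define d where "d = a * b / (q * b powr q)"
      have cd: "0 \<le> c" "0 \<le> d" using ab 2 by (auto simp: c_def d_def)
      have "(\<integral>\<^sup>+x. ennreal (norm (u x) * norm (v x)) \<partial>M) \<le>
         (\<integral>\<^sup>+x. ennreal c * ennreal (norm (u x) powr p) + ennreal d * ennreal (norm (v x) powr q) \<partial>M)"
      proof (rule nn_integral_mono)
        fix x
        have "(norm (u x) / a) * (norm (v x) / b) \<le> (norm (u x) / a) powr p / p + (norm (v x) / b) powr q / q"
          using 2 ab by (intro Youngs_inequality) auto
        then have "a * b * ((norm (u x) / a) * (norm (v x) / b)) \<le>
            a * b * ((norm (u x) / a) powr p / p + (norm (v x) / b) powr q / q)"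
          using ab by (intro mult_left_mono) auto
        also have "\<dots> = c * norm (u x) powr p + d * norm (v x) powr q"
          using ab by (simp add: c_def d_def powr_divide distrib_left mult.commute)
        finally have "norm (u x) * norm (v x) \<le> c * norm (u x) powr p + d * norm (v x) powr q"
          using ab by simp
        then show "ennreal (norm (u x) * norm (v x)) \<le> ennreal c * ennreal (norm (u x) powr p) + ennreal d * ennreal (norm (v x) powr q)"
          using cd by (simp flip: ennreal_mult ennreal_plus)
      qed
      also have "\<dots> = ennreal c * (\<integral>\<^sup>+x. ennreal (norm (u x) powr p) \<partial>M) + ennreal d * (\<integral>\<^sup>+x. ennreal (norm (v x) powr q) \<partial>M)"
        by (simp add: nn_integral_add nn_integral_cmult)
      also have "\<dots> = ennreal c * ennreal (a powr p) + ennreal d * ennreal (b powr q)"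
        using nn_integral_powr_eq_eLp_norm[OF p a(1)[unfolded 2] a(2)] nn_integral_powr_eq_eLp_norm[OF q b] by simp
      also have "\<dots> = ennreal (c * a powr p + d * b powr q)"
        using cd by (simp flip: ennreal_mult ennreal_plus)
      also have "c * a powr p + d * b powr q = a * b * (1 / p + 1 / q)"
        using ab by (simp add: c_def d_def distrib_left)
      also have "\<dots> = a * b" using 2 by simp
      finally show ?thesis using a b by (simp add: ennreal_mult)
    qed
  qed
qed

section \<open>Invariance of Lebesgue measure\<close>

lemma distr_affine_lebesgue:
  fixes c :: real
  assumes "\<bar>c\<bar> = 1"
  shows "distr lebesgue lebesgue (\<lambda>x. t + c * x) = lebesgue" "(\<lambda>x. t + c * x) \<in> lebesgue \<rightarrow>\<^sub>M lebesgue"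
proof -
  have "c \<noteq> 0" using assms by auto
  from lebesgue_real_affine[OF this, of t] show "distr lebesgue lebesgue (\<lambda>x. t + c * x) = lebesgue"
    using assms by (simp add: density_1)
  show "(\<lambda>x. t + c * x) \<in> lebesgue \<rightarrow>\<^sub>M lebesgue"
    using lebesgue_affine_measurable[where c="\<lambda>x::real. c" and t=t] \<open>c \<noteq> 0\<close> by simp
qed

lemma distr_restrict_space_eq:
  assumes T: "T \<in> M \<rightarrow>\<^sub>M N" and d: "distr M N T = N" and S: "S \<in> sets N" and S': "S' = T -` S \<inter> space M"
  shows "distr (restrict_space M S') (restrict_space N S) T = restrict_space N S"
    "T \<in> restrict_space M S' \<rightarrow>\<^sub>M restrict_space N S"
proof -
  have S'M: "S' \<in> sets M" unfolding S' by (rule measurable_sets[OF T S])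
  show m: "T \<in> restrict_space M S' \<rightarrow>\<^sub>M restrict_space N S"
    by (rule measurable_restrict_space3[OF T]) (auto simp: S')
  show "distr (restrict_space M S') (restrict_space N S) T = restrict_space N S"
  proof (rule measure_eqI)
    fix A assume "A \<in> sets (distr (restrict_space M S') (restrict_space N S) T)"
    then have A: "A \<in> sets N" "A \<subseteq> S" and A': "A \<in> sets (restrict_space N S)"
      using S by (auto simp: sets_restrict_space_iff)
    have eq: "T -` A \<inter> space (restrict_space M S') = T -` A \<inter> space M"
      using A by (auto simp: S' space_restrict_space)
    have "emeasure (distr (restrict_space M S') (restrict_space N S) T) A = emeasure (restrict_space M S') (T -` A \<inter> space M)"
      by (simp add: emeasure_distr[OF m A'] eq)
    also have "\<dots> = emeasure M (T -` A \<inter> space M)"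
      using S'M A by (intro emeasure_restrict_space) (auto simp: S')
    also have "\<dots> = emeasure N A" using emeasure_distr[OF T A(1)] d by simp
    also have "\<dots> = emeasure (restrict_space N S) A"
      using S A by (intro emeasure_restrict_space[symmetric]) auto
    finally show "emeasure (distr (restrict_space M S') (restrict_space N S) T) A = emeasure (restrict_space N S) A" .
  qed simp
qed

lemma distr_reflect_lebesgue:
  "distr lebesgue lebesgue (\<lambda>s::real. c - s) = lebesgue" "(\<lambda>s::real. c - s) \<in> lebesgue \<rightarrow>\<^sub>M lebesgue"
  using distr_affine_lebesgue[of "-1" c] by simp_all

lemma distr_shift_lebesgue:
  "distr lebesgue lebesgue (\<lambda>s::real. c + s) = lebesgue" "(\<lambda>s::real. c + s) \<in> lebesgue \<rightarrow>\<^sub>M lebesgue"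
  using distr_affine_lebesgue[of 1 c] by simp_all

lemma distr_reflect_lebesgue_on:
  fixes a b c :: real
  shows "distr (lebesgue_on {c-b..c-a}) (lebesgue_on {a..b}) (\<lambda>s. c - s) = lebesgue_on {a..b}"
    "(\<lambda>s. c - s) \<in> lebesgue_on {c-b..c-a} \<rightarrow>\<^sub>M lebesgue_on {a..b}"
  by (rule distr_restrict_space_eq[OF distr_reflect_lebesgue(2,1)]; auto)+

lemma eLp_norm_compose:
  assumes q: "1 \<le> q" and T: "T \<in> M \<rightarrow>\<^sub>M N" and d: "distr M N T = N"
    and f: "(\<lambda>x. norm (f x)) \<in> borel_measurable N"
  shows "eLp_norm (ennreal q) M (\<lambda>x. f (T x)) = eLp_norm (ennreal q) N f"
proof -
  have "(\<integral>\<^sup>+x. ennreal (norm (f (T x)) powr q) \<partial>M) = (\<integral>\<^sup>+x. ennreal (norm (f x) powr q) \<partial>N)"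
    using nn_integral_distr[OF T, of "\<lambda>x. ennreal (norm (f x) powr q)"] d f by simp
  then show ?thesis by (simp add: eLp_norm_real[OF q])
qed

lemma emeasure_lebesgue_on_unit: "emeasure (lebesgue_on {t..t+1::real}) (space (lebesgue_on {t..t+1})) \<le> 1"
  by (simp add: emeasure_restrict_space)

text \<open>The norm of \<open>s \<mapsto> F (t - s)\<close> on \<open>[a, a + 1]\<close> is a Stepanov norm: the substitution
  \<open>s \<mapsto> a + 1 - s\<close> maps this interval onto \<open>[0, 1]\<close>.\<close>

lemma eLp_norm_reflect_hat:
  assumes q: "1 \<le> q" and F: "strongly_measurable lebesgue F"
  shows "eLp_norm (ennreal q) (lebesgue_on {a..a+1}) (\<lambda>s. F (t - s)) =
    eLp_norm (ennreal q) (lebesgue_on {0..1}) (hat F (t - a - 1))"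
proof -
  have "strongly_measurable lebesgue (hat F (t - a - 1))"
    unfolding hat_def by (rule strongly_measurable_compose[OF distr_shift_lebesgue(2,1) F])
  then have "(\<lambda>x. norm (hat F (t - a - 1) x)) \<in> borel_measurable (lebesgue_on {0..1})"
    by (intro borel_measurable_norm_strongly_measurable complete_lebesgue_on strongly_measurable_restrict) auto
  from eLp_norm_compose[OF q _ _ this, of "\<lambda>s. a + 1 - s" "lebesgue_on {a..a+1}"]
    distr_reflect_lebesgue_on[of "a+1" 1 0]
  show ?thesis by (simp add: hat_def algebra_simps)
qed

text \<open>Tannery's theorem, transported from the reals; all terms are finite.\<close>

lemma tendsto_suminf_ennreal_0:
  fixes A :: "nat \<Rightarrow> ennreal"
  assumes A: "(\<Sum>j. A j) < \<infinity>" and D: "\<And>l j. D l j \<le> ennreal B"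
    and lim: "\<And>j. ((\<lambda>l. D l j) \<longlongrightarrow> 0) F"
  shows "((\<lambda>l. \<Sum>j. A j * D l j) \<longlongrightarrow> 0) F"
proof (cases "F = bot")
  case False
  have Aj: "A j < \<infinity>" for j using ennreal_suminf_lessD[OF A] .
  define a where "a j = enn2real (A j)" for j
  define d where "d l j = enn2real (D l j)" for l j
  have Aa: "A j = ennreal (a j)" for j using Aj[of j] by (simp add: a_def less_top)
  have Dt: "D l j < top" for l j using D[of l j] by (auto intro: le_less_trans)
  then have Dd: "D l j = ennreal (d l j)" for l j by (simp add: d_def)
  have nn: "0 \<le> a j" "0 \<le> d l j" for l j by (auto simp: a_def d_def)
  have sa: "summable a"
    using A nn unfolding Aa by (intro summable_suminf_not_top) auto
  have dB: "d l j \<le> \<bar>B\<bar>" for l j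
    using D[of l j] unfolding Dd by (cases "B \<ge> 0") (auto simp: ennreal_neg nn ennreal_le_iff)
  have sB: "summable (\<lambda>j. a j * \<bar>B\<bar>)" by (rule summable_mult2[OF sa])
  have dl: "((\<lambda>l. d l j) \<longlongrightarrow> 0) F" for j
    using lim[of j] tendsto_ennreal_iff[of "\<lambda>l. d l j" F 0] nn unfolding Dd by simp
  have "eventually (\<lambda>l. summable (\<lambda>j. norm (a j * d l j))) F \<and> summable (\<lambda>j. norm (0::real)) \<and>
      ((\<lambda>l. \<Sum>j. a j * d l j) \<longlongrightarrow> (\<Sum>j::nat. 0)) F"
  proof (rule tannerys_theorem[where M="\<lambda>j. a j * \<bar>B\<bar>"])
    show "((\<lambda>l. a k * d l k) \<longlongrightarrow> 0) F" for k
      using tendsto_mult_left[OF dl, of "a k" k] by simp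
    show "\<forall>\<^sub>F (k, n) in at_top \<times>\<^sub>F F. norm (a k * d n k) \<le> a k * \<bar>B\<bar>"
      using nn dB by (intro always_eventually) (auto simp: abs_mult intro!: mult_left_mono)
  qed (use sB False in auto)
  then have "((\<lambda>l. ennreal (\<Sum>j. a j * d l j)) \<longlongrightarrow> 0) F"
    using tendsto_ennrealI by fastforce
  moreover have "(\<Sum>j. A j * D l j) = ennreal (\<Sum>j. a j * d l j)" for l
  proof -
    have s: "summable (\<lambda>j. a j * d l j)"
      by (rule summable_comparison_test'[OF sB, of 0]) (use nn dB in \<open>auto simp: abs_mult intro!: mult_left_mono\<close>)
    have "(\<Sum>j. A j * D l j) = (\<Sum>j. ennreal (a j * d l j))"
      by (simp add: Aa Dd ennreal_mult nn)
    also have "\<dots> = ennreal (\<Sum>j. a j * d l j)"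
      using s nn by (intro suminf_ennreal_eq) (auto simp: summable_sums)
    finally show ?thesis .
  qed
  ultimately show ?thesis by simp
qed simp

section \<open>Measurability along a strongly continuous operator family\<close>

text \<open>Banach--Steinhaus for sequences, by the Baire category theorem: one of the closed sets where
  all \<open>\<parallel>T\<^sub>n x\<parallel>\<close> are at most \<open>k\<close> contains a ball, and its points differ from the centre by
  arbitrary vectors of the norm \<open>r\<close>.\<close>

lemma uniform_boundedness:
  fixes T :: "nat \<Rightarrow> ('a::banach \<Rightarrow>\<^sub>L 'b::real_normed_vector)"
  assumes bdd: "\<And>x. bounded (range (\<lambda>n. blinfun_apply (T n) x))"
  shows "\<exists>K. \<forall>n. norm (T n) \<le> K"
proof -
  define C where "C k = {x. \<forall>n. norm (blinfun_apply (T n) x) \<le> real k}" for k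
  have cl: "closed (C k)" for k
    unfolding C_def by (intro closed_Collect_all closed_Collect_le continuous_intros)
  have "\<Union>(range C) = UNIV"
  proof (rule set_eqI, simp)
    fix x
    obtain b where b: "\<And>n. norm (blinfun_apply (T n) x) \<le> b" using bdd[of x] by (auto simp: bounded_iff)
    obtain k where "b < real k" using reals_Archimedean2 by blast
    then have "norm (blinfun_apply (T n) x) \<le> real k" for n using b[of n] by linarith
    then show "\<exists>k. x \<in> C k" unfolding C_def by blast
  qed
  have "\<exists>k. interior (C k) \<noteq> {}"
  proof (rule ccontr)
    assume "\<not> ?thesis"
    then have "Met_TC.mtopology interior_of \<Union>(range C) = {}"
      by (intro Met_TC.metric_Baire_category_alt) (auto simp: complete_UNIV cl)
    then show False using \<open>\<Union>(range C) = UNIV\<close> by simp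
  qed
  then obtain k x0 where "x0 \<in> interior (C k)" by blast
  then obtain r where r: "0 < r" "cball x0 r \<subseteq> C k"
    by (auto simp: mem_interior_cball)
  have "norm (T n) \<le> 2 * real k / r" for n
  proof (rule norm_blinfun_bound)
    fix x
    show "norm (blinfun_apply (T n) x) \<le> 2 * real k / r * norm x"
    proof (cases "x = 0")
      case False
      define y where "y = (r / norm x) *\<^sub>R x"
      have "norm y = r" using False r by (simp add: y_def)
      then have "x0 + y \<in> cball x0 r" "x0 \<in> cball x0 r" using r by (auto simp: dist_norm)
      then have "x0 + y \<in> C k" "x0 \<in> C k" using r(2) by blast+
      then have "norm (blinfun_apply (T n) (x0 + y)) \<le> real k" "norm (blinfun_apply (T n) x0) \<le> real k"
        by (simp_all add: C_def)
      then have "norm (blinfun_apply (T n) y) \<le> 2 * real k"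
        using norm_triangle_ineq4[of "blinfun_apply (T n) (x0 + y)" "blinfun_apply (T n) x0"]
        by (simp add: blinfun.add_right)
      moreover have "norm (blinfun_apply (T n) y) = r / norm x * norm (blinfun_apply (T n) x)"
        using r by (simp add: y_def blinfun.scaleR_right)
      ultimately show ?thesis using False r by (simp add: field_simps)
    qed simp
  qed (use r in simp)
  then show ?thesis by blast
qed

text \<open>Rounding up to the grid of mesh \<open>1 / (n + 1)\<close>, inside \<open>[-n, n]\<close>. Rounding up, and the
  value \<open>1\<close> outside, keep positive times positive, where the operator family is continuous.\<close>

lemma simple_discretization:
  obtains \<theta> :: "nat \<Rightarrow> real \<Rightarrow> real"
  where "\<And>n. simple_function lebesgue (\<theta> n)" "\<And>x. (\<lambda>n. \<theta> n x) \<longlonglongrightarrow> x"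
    "\<And>n x. 0 < x \<Longrightarrow> 0 < \<theta> n x"
proof
  define \<theta> where "\<theta> n x = (if \<bar>x\<bar> \<le> real n then of_int \<lceil>real (Suc n) * x\<rceil> / real (Suc n) else 1)" for n and x :: real
  show "simple_function lebesgue (\<theta> n)" for n
  proof (rule simple_function_borel_measurable)
    have "\<theta> n \<in> borel_measurable borel" unfolding \<theta>_def by measurable
    then show "\<theta> n \<in> borel_measurable lebesgue"
      by (simp add: measurable_completion)
    have "range (\<theta> n) \<subseteq> insert 1 ((\<lambda>k. of_int k / real (Suc n)) ` {- (int (Suc n) * int n)..int (Suc n) * int n})"
    proof
      fix y assume "y \<in> range (\<theta> n)"
      then obtain x where y: "y = \<theta> n x" by blast
      show "y \<in> insert 1 ((\<lambda>k. of_int k / real (Suc n)) ` {- (int (Suc n) * int n)..int (Suc n) * int n})"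
      proof (cases "\<bar>x\<bar> \<le> real n")
        case True
        then have "real (Suc n) * \<bar>x\<bar> \<le> real (Suc n) * real n" by (intro mult_left_mono) auto
        then have "\<bar>real (Suc n) * x\<bar> \<le> of_int (int (Suc n) * int n)" by (simp add: abs_mult)
        then have "real (Suc n) * x \<le> of_int (int (Suc n) * int n)" "of_int (- (int (Suc n) * int n)) \<le> real (Suc n) * x"
          by linarith+
        then have "\<lceil>real (Suc n) * x\<rceil> \<le> int (Suc n) * int n" "- (int (Suc n) * int n) \<le> \<lceil>real (Suc n) * x\<rceil>"
          by (simp_all only: ceiling_le_iff) (meson ceiling_mono ceiling_of_int order_trans le_of_int_ceiling of_int_le_iff)
        then show ?thesis using True by (auto simp: y \<theta>_def)
      qed (simp add: y \<theta>_def)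
    qed
    then have "finite (range (\<theta> n))" by (rule finite_subset) auto
    then show "finite (\<theta> n ` space lebesgue)" by simp
  qed
  show "(\<lambda>n. \<theta> n x) \<longlonglongrightarrow> x" for x
  proof (rule LIM_zero_cancel, rule Lim_null_comparison)
    show "(\<lambda>n. 1 / real (Suc n)) \<longlonglongrightarrow> 0" by (rule LIMSEQ_Suc[OF lim_1_over_n])
    have "\<forall>\<^sub>F n in sequentially. \<bar>x\<bar> \<le> real n"
      using eventually_ge_at_top[of "nat \<lceil>\<bar>x\<bar>\<rceil>"] by eventually_elim linarith
    then show "\<forall>\<^sub>F n in sequentially. norm (\<theta> n x - x) \<le> 1 / real (Suc n)"
    proof eventually_elim
      case (elim n)
      have "\<theta> n x - x = (of_int \<lceil>real (Suc n) * x\<rceil> - real (Suc n) * x) / real (Suc n)"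
        using elim by (simp add: \<theta>_def field_simps)
      moreover have "\<bar>of_int \<lceil>real (Suc n) * x\<rceil> - real (Suc n) * x\<bar> \<le> 1" by linarith
      ultimately show ?case by (simp add: divide_right_mono)
    qed
  qed
  show "0 < \<theta> n x" if "0 < x" for n x
  proof -
    have "0 < real (Suc n) * x" using that by simp
    then have "0 < \<lceil>real (Suc n) * x\<rceil>" by (simp only: zero_less_ceiling)
    then show ?thesis by (simp add: \<theta>_def)
  qed
qed

lemma strongly_measurable_continuous:
  fixes u :: "real \<Rightarrow> 'a::real_normed_vector"
  assumes "continuous_on UNIV u"
  shows "strongly_measurable lebesgue u"
proof -
  obtain \<theta> :: "nat \<Rightarrow> real \<Rightarrow> real"
    where \<theta>: "\<And>n. simple_function lebesgue (\<theta> n)" "\<And>x. (\<lambda>n. \<theta> n x) \<longlonglongrightarrow> x"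
    by (rule simple_discretization) blast
  have "simple_function lebesgue (\<lambda>x. u (\<theta> n x))" for n by (rule simple_function_compose1[OF \<theta>(1)])
  moreover have "(\<lambda>n. u (\<theta> n x)) \<longlonglongrightarrow> u x" for x
    using continuous_on_tendsto_compose[OF assms \<theta>(2)] by simp
  ultimately show ?thesis unfolding strongly_measurable_def by (intro exI[of _ "\<lambda>n x. u (\<theta> n x)"]) simp
qed

text \<open>With discretised times \<open>\<theta>\<^sub>n s \<rightarrow> s\<close> and simple functions \<open>\<sigma>\<^sub>n \<rightarrow> F\<close>, the simple functions
  \<open>R(\<theta>\<^sub>n s) (\<sigma>\<^sub>n s)\<close> converge to \<open>R(s) (F s)\<close>: strong continuity deals with the fixed vector
  \<open>F s\<close>, and the remaining vectors \<open>\<sigma>\<^sub>n s - F s\<close> tend to \<open>0\<close> while the norms of the convergent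
  sequence \<open>R(\<theta>\<^sub>n s)\<close> are bounded by the uniform boundedness principle.\<close>

lemma strongly_measurable_blinfun_apply:
  fixes R :: "real \<Rightarrow> ('a::banach \<Rightarrow>\<^sub>L 'b::real_normed_vector)"
  assumes R: "strongly_continuous_on {0<..} R" and F: "strongly_measurable lebesgue F"
  shows "strongly_measurable (lebesgue_on {0..}) (\<lambda>s. blinfun_apply (R s) (F s))"
proof -
  obtain \<theta> :: "nat \<Rightarrow> real \<Rightarrow> real"
    where \<theta>: "\<And>n. simple_function lebesgue (\<theta> n)" "\<And>x. (\<lambda>n. \<theta> n x) \<longlonglongrightarrow> x" "\<And>n x. 0 < x \<Longrightarrow> 0 < \<theta> n x"
    by (rule simple_discretization) blast
  obtain \<sigma> where \<sigma>: "\<And>i::nat. simple_function lebesgue (\<sigma> i)" and ls: "AE x in lebesgue. (\<lambda>i. \<sigma> i x) \<longlonglongrightarrow> F x"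
    using F unfolding strongly_measurable_def by blast
  have conv: "(\<lambda>n. blinfun_apply (R (\<theta> n s)) (\<sigma> n s)) \<longlonglongrightarrow> blinfun_apply (R s) (F s)"
    if s: "0 < s" and l: "(\<lambda>i. \<sigma> i s) \<longlonglongrightarrow> F s" for s
  proof -
    have lx: "(\<lambda>n. blinfun_apply (R (\<theta> n s)) x) \<longlonglongrightarrow> blinfun_apply (R s) x" for x
    proof (rule continuous_on_tendsto_compose[OF _ \<theta>(2)])
      show "continuous_on {0<..} (\<lambda>t. blinfun_apply (R t) x)" using R by (simp add: strongly_continuous_on_def)
    qed (use s \<theta>(3) in auto)
    then have "\<exists>K. \<forall>n. norm (R (\<theta> n s)) \<le> K"
      by (intro uniform_boundedness convergent_imp_bounded)
    then obtain K where K: "\<And>n. norm (R (\<theta> n s)) \<le> K" by blast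
    have "(\<lambda>n. blinfun_apply (R (\<theta> n s)) (\<sigma> n s - F s)) \<longlonglongrightarrow> 0"
    proof (rule Lim_null_comparison)
      show "(\<lambda>n. K * norm (\<sigma> n s - F s)) \<longlonglongrightarrow> 0"
        using tendsto_mult_left[OF tendsto_norm_zero[OF LIM_zero[OF l]], of K] by simp
      show "\<forall>\<^sub>F n in sequentially. norm (blinfun_apply (R (\<theta> n s)) (\<sigma> n s - F s)) \<le> K * norm (\<sigma> n s - F s)"
        by (intro always_eventually allI order_trans[OF norm_blinfun] mult_right_mono K) simp
    qed
    from tendsto_add[OF this lx[of "F s"]] show ?thesis by (simp add: blinfun.diff_right)
  qed
  have meas: "simple_function lebesgue (\<lambda>s. blinfun_apply (R (\<theta> n s)) (\<sigma> n s))" for n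
    by (rule simple_function_compose2[OF \<theta>(1) \<sigma>])
  have ne0: "AE s in lebesgue. s \<noteq> (0::real)"
    by (rule AE_I'[of "{0}"]) auto
  define w where "w n s = (if s \<in> {0..} then blinfun_apply (R (\<theta> n s)) (\<sigma> n s) else 0)" for n s
  have "simple_function lebesgue (w n)" for n
    unfolding w_def by (rule simple_function_If_set[OF meas simple_function_const]) simp
  moreover have "AE s in lebesgue. (\<lambda>n. w n s) \<longlonglongrightarrow> (if s \<in> {0..} then blinfun_apply (R s) (F s) else 0)"
    using ne0 ls by eventually_elim (auto simp: w_def intro: conv)
  ultimately have "strongly_measurable lebesgue (\<lambda>s. if s \<in> {0..} then blinfun_apply (R s) (F s) else 0)"
    unfolding strongly_measurable_def by blast
  then have "strongly_measurable (lebesgue_on {0..}) (\<lambda>s. if s \<in> {0..} then blinfun_apply (R s) (F s) else 0)"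
    by (rule strongly_measurable_restrict) simp
  then show ?thesis
    by (rule strongly_measurable_AE_cong) (auto intro!: AE_I2)
qed

text \<open>On \<open>(0, \<infinity>)\<close> the operator norm is lower semicontinuous, as a supremum of the continuous
  functions \<open>s \<mapsto> \<parallel>R(s) x\<parallel> / \<parallel>x\<parallel>\<close>. The value at \<open>0\<close> is arbitrary and adds at most one point.\<close>

lemma borel_measurable_norm_strongly_continuous:
  fixes R :: "real \<Rightarrow> ('a::real_normed_vector \<Rightarrow>\<^sub>L 'b::real_normed_vector)"
  assumes R: "strongly_continuous_on {0<..} R"
  shows "(\<lambda>s. norm (R s)) \<in> borel_measurable (lebesgue_on {0..})"
proof (subst borel_measurable_iff_greater, intro allI)
  fix a :: real
  define U where "U = (\<Union>x. {s \<in> {0<..}. a * norm x < norm (blinfun_apply (R s) x)})"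
  have "open U"
    unfolding U_def
  proof (intro open_UN ballI)
    fix x
    have "continuous_on {0<..} (\<lambda>t. norm (blinfun_apply (R t) x))"
      using R by (intro continuous_on_norm) (simp add: strongly_continuous_on_def)
    then have "open ({0<..} \<inter> (\<lambda>t. norm (blinfun_apply (R t) x)) -` {a * norm x<..})"
      by (rule continuous_open_preimage) auto
    moreover have "{0<..} \<inter> (\<lambda>t. norm (blinfun_apply (R t) x)) -` {a * norm x<..} = {s \<in> {0<..}. a * norm x < norm (blinfun_apply (R s) x)}"
      by auto
    ultimately show "open {s \<in> {0<..}. a * norm x < norm (blinfun_apply (R s) x)}" by simp
  qed
  have "s \<in> U \<longleftrightarrow> a < norm (R s)" if a: "0 \<le> a" and s: "0 < s" for s
  proof
    assume "s \<in> U"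
    then obtain x where "a * norm x < norm (blinfun_apply (R s) x)" by (auto simp: U_def)
    also have "\<dots> \<le> norm (R s) * norm x" by (rule norm_blinfun)
    finally show "a < norm (R s)" by (simp add: mult_less_cancel_right)
  next
    assume "a < norm (R s)"
    then have "\<not> (\<forall>x. norm (blinfun_apply (R s) x) \<le> a * norm x)"
      using norm_blinfun_bound[OF a, of "R s"] by auto
    then show "s \<in> U" using s by (auto simp: U_def not_le)
  qed
  then have pos: "{s \<in> {0<..}. a < norm (R s)} = (if 0 \<le> a then U \<inter> {0<..} else {0<..})"
    by (auto intro: less_le_trans[of a 0])
  have "{s \<in> space (lebesgue_on {0..}). a < norm (R s)} = {s \<in> {0<..}. a < norm (R s)} \<union> (if a < norm (R 0) then {0} else {})"
    by (auto simp: less_le)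
  moreover have "{s \<in> {0<..}. a < norm (R s)} \<in> sets lebesgue"
    unfolding pos using \<open>open U\<close> by auto
  moreover have "(if a < norm (R 0) then {0} else {}) \<in> sets (lebesgue :: real measure)" by simp
  ultimately have "{w \<in> space (lebesgue_on {0..}). a < norm (R w)} \<in> sets lebesgue"
    by (simp only: sets.Un)
  then show "{w \<in> space (lebesgue_on {0..}). a < norm (R w)} \<in> sets (lebesgue_on {0..})"
    by (subst sets_restrict_space_iff) (simp_all add: subset_iff)
qed

section \<open>Convolution with a summable operator kernel\<close>

lemma nn_integral_halfline_le:
  assumes w: "w \<in> borel_measurable (lebesgue_on {0::real..})"
  shows "(\<integral>\<^sup>+s. w s \<partial>lebesgue_on {0..}) \<le> (\<Sum>j. \<integral>\<^sup>+s. w s \<partial>lebesgue_on {real j..real j + 1})"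
proof -
  have m: "(\<lambda>s. w s * indicator {0..} s) \<in> borel_measurable lebesgue"
    using w by (subst (asm) borel_measurable_restrict_space_iff_ennreal) auto
  have "(\<integral>\<^sup>+s. w s \<partial>lebesgue_on {0..}) = (\<integral>\<^sup>+s. w s * indicator {0..} s \<partial>lebesgue)"
    by (rule nn_integral_restrict_space) simp
  also have "\<dots> \<le> (\<integral>\<^sup>+s. (\<Sum>j. w s * indicator {0..} s * indicator {real j..real j + 1} s) \<partial>lebesgue)"
  proof (rule nn_integral_mono)
    fix s :: real
    show "w s * indicator {0..} s \<le> (\<Sum>j. w s * indicator {0..} s * indicator {real j..real j + 1} s)"
    proof (cases "0 \<le> s")
      case True
      define j where "j = nat \<lfloor>s\<rfloor>"
      have "s \<in> {real j..real j + 1}" using True unfolding j_def by auto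
      then have "w s * indicator {0..} s = w s * indicator {0..} s * indicator {real j..real j + 1} s" by simp
      also have "\<dots> = sum (\<lambda>j. w s * indicator {0..} s * indicator {real j..real j + 1} s) {j}"
        by (simp only: sum.insert finite.emptyI empty_iff not_False_eq_True sum.empty add_0_right)
      also have "\<dots> \<le> (\<Sum>j. w s * indicator {0..} s * indicator {real j..real j + 1} s)"
        by (rule sum_le_suminf) (simp_all only: summableI finite.emptyI finite.insertI zero_le)
      finally show ?thesis .
    qed simp
  qed
  also have "\<dots> = (\<Sum>j. \<integral>\<^sup>+s. w s * indicator {0..} s * indicator {real j..real j + 1} s \<partial>lebesgue)"
    by (intro nn_integral_suminf borel_measurable_times_ennreal[OF m] borel_measurable_indicator) simp
  also have "\<dots> = (\<Sum>j. \<integral>\<^sup>+s. w s \<partial>lebesgue_on {real j..real j + 1})"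
    by (intro suminf_cong, subst nn_integral_restrict_space)
      (auto intro!: nn_integral_cong simp: indicator_def)
  finally show ?thesis .
qed

lemma strongly_measurable_shift:
  fixes F :: "real \<Rightarrow> 'a::real_normed_vector"
  assumes "strongly_measurable lebesgue F"
  shows "strongly_measurable lebesgue (\<lambda>s. F (t + s))"
  by (rule strongly_measurable_compose[OF distr_shift_lebesgue(2,1) assms])

lemma strongly_measurable_reflect:
  fixes F :: "real \<Rightarrow> 'a::real_normed_vector"
  assumes "strongly_measurable lebesgue F"
  shows "strongly_measurable lebesgue (\<lambda>s. F (t - s))"
  by (rule strongly_measurable_compose[OF distr_reflect_lebesgue(2,1) assms])

lemma strongly_measurable_lebesgue_on:
  "strongly_measurable lebesgue F \<Longrightarrow> S \<in> sets lebesgue \<Longrightarrow> strongly_measurable (lebesgue_on S) F"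
  by (rule strongly_measurable_restrict) simp_all

lemma strongly_measurable_hat:
  "strongly_measurable lebesgue F \<Longrightarrow> strongly_measurable (lebesgue_on {0..1}) (hat F x)"
  unfolding hat_def by (intro strongly_measurable_lebesgue_on strongly_measurable_shift) auto

lemma borel_measurable_norm_hat:
  "strongly_measurable lebesgue F \<Longrightarrow> (\<lambda>s. norm (hat F x s)) \<in> borel_measurable (lebesgue_on {0..1})"
  by (intro borel_measurable_norm_strongly_measurable complete_lebesgue_on strongly_measurable_hat) auto

lemma eLp_norm_scaleC:
  fixes f :: "'a \<Rightarrow> 'b::complex_normed_vector"
  assumes q: "1 \<le> q" and f: "eLp_norm (ennreal q) M f \<le> ennreal B" "0 \<le> B"
    and m[measurable]: "(\<lambda>x. norm (f x)) \<in> borel_measurable M"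
  shows "eLp_norm (ennreal q) M (c *\<^sub>C f) \<le> ennreal (cmod c * B)"
proof -
  have "(\<integral>\<^sup>+x. ennreal (norm ((c *\<^sub>C f) x) powr q) \<partial>M) = (\<integral>\<^sup>+x. ennreal (cmod c powr q) * ennreal (norm (f x) powr q) \<partial>M)"
    by (intro nn_integral_cong) (simp add: scaleC_fun_def norm_scaleC powr_mult ennreal_mult)
  also have "\<dots> = ennreal (cmod c powr q) * (\<integral>\<^sup>+x. ennreal (norm (f x) powr q) \<partial>M)"
    by (rule nn_integral_cmult) measurable
  also have "\<dots> \<le> ennreal (cmod c powr q) * ennreal (B powr q)"
    using f by (intro mult_left_mono) (auto simp: eLp_norm_le_iff[OF q])
  also have "\<dots> = ennreal ((cmod c * B) powr q)" using f by (simp add: powr_mult ennreal_mult)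
  finally show ?thesis using f by (simp add: eLp_norm_le_iff[OF q])
qed

locale summable_kernel =
  fixes R :: "real \<Rightarrow> ('e::{complex_normed_vector, banach} \<Rightarrow>\<^sub>L 'x::{complex_normed_vector, banach})"
    and q :: real and q' :: ennreal
  assumes q: "1 \<le> q" and q': "1 / q' + 1 / ennreal q = 1"
    and R_linear: "\<And>t. t > 0 \<Longrightarrow> complex_linear (blinfun_apply (R t))"
    and R_cont: "strongly_continuous_on {0<..} R"
    and R_summable: "(\<Sum>j. eLp_norm q' (lebesgue_on {real j..real j + 1}) R) < \<infinity>"
begin

text \<open>Integrating over the half-line, and not over \<open>[0, t]\<close>, makes the convolution commute with
  translations; the integral over \<open>[0, t]\<close> is recovered for functions that vanish at negative
  arguments.\<close>

definition conv :: "(real \<Rightarrow> 'e) \<Rightarrow> real \<Rightarrow> 'x"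
  where "conv F t = bochner_integral (lebesgue_on {0..}) (\<lambda>s. blinfun_apply (R s) (F (t - s)))"

definition weight :: "nat \<Rightarrow> ennreal"
  where "weight j = eLp_norm q' (lebesgue_on {real j..real j + 1}) R"

abbreviation L01 :: "(real \<Rightarrow> 'e) \<Rightarrow> ennreal"
  where "L01 \<equiv> eLp_norm (ennreal q) (lebesgue_on {0..1})"

definition translation_bounded :: "real \<Rightarrow> (real \<Rightarrow> 'e) \<Rightarrow> bool"
  where "translation_bounded B F \<longleftrightarrow> 0 \<le> B \<and> strongly_measurable lebesgue F \<and> (\<forall>x. L01 (hat F x) \<le> ennreal B)"

lemma weight_summable: "(\<Sum>j. weight j) < \<infinity>"
  unfolding weight_def by (rule R_summable)

lemma nn_integral_conv_le:
  assumes F: "strongly_measurable lebesgue F"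
  shows "(\<integral>\<^sup>+s. ennreal (norm (blinfun_apply (R s) (F (t - s)))) \<partial>lebesgue_on {0..})
    \<le> (\<Sum>j. weight j * L01 (hat F (t - real j - 1)))"
proof -
  note FR = strongly_measurable_reflect[OF F, of t]
  have "(\<lambda>s. norm (blinfun_apply (R s) (F (t - s)))) \<in> borel_measurable (lebesgue_on {0..})"
    by (intro borel_measurable_norm_strongly_measurable complete_lebesgue_on
        strongly_measurable_blinfun_apply[OF R_cont FR]) simp
  then have "(\<integral>\<^sup>+s. ennreal (norm (blinfun_apply (R s) (F (t - s)))) \<partial>lebesgue_on {0..})
      \<le> (\<Sum>j. \<integral>\<^sup>+s. ennreal (norm (blinfun_apply (R s) (F (t - s)))) \<partial>lebesgue_on {real j..real j + 1})"
    by (rule nn_integral_halfline_le[OF measurable_compose[OF _ measurable_ennreal]])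
  also have "\<dots> \<le> (\<Sum>j. weight j * L01 (hat F (t - real j - 1)))"
  proof (intro suminf_le summableI)
    fix j
    have "(\<integral>\<^sup>+s. ennreal (norm (blinfun_apply (R s) (F (t - s)))) \<partial>lebesgue_on {real j..real j + 1})
      \<le> (\<integral>\<^sup>+s. ennreal (norm (R s) * norm (F (t - s))) \<partial>lebesgue_on {real j..real j + 1})"
      by (intro nn_integral_mono ennreal_leI norm_blinfun)
    also have "\<dots> \<le> eLp_norm q' (lebesgue_on {real j..real j + 1}) R *
        eLp_norm (ennreal q) (lebesgue_on {real j..real j + 1}) (\<lambda>s. F (t - s))"
    proof (rule Hoelder_eLp_norm[OF q q'])
      show "(\<lambda>x. norm (R x)) \<in> borel_measurable (lebesgue_on {real j..real j + 1})"
        by (rule measurable_restrict_mono[OF borel_measurable_norm_strongly_continuous[OF R_cont]]) auto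
      show "(\<lambda>x. norm (F (t - x))) \<in> borel_measurable (lebesgue_on {real j..real j + 1})"
        by (intro borel_measurable_norm_strongly_measurable complete_lebesgue_on
            strongly_measurable_lebesgue_on[OF FR]) auto
    qed
    also have "\<dots> = weight j * L01 (hat F (t - real j - 1))"
      by (simp add: weight_def eLp_norm_reflect_hat[OF q F])
    finally show "(\<integral>\<^sup>+s. ennreal (norm (blinfun_apply (R s) (F (t - s)))) \<partial>lebesgue_on {real j..real j + 1})
      \<le> weight j * L01 (hat F (t - real j - 1))" .
  qed
  finally show ?thesis .
qed

lemma nn_integral_conv_finite:
  assumes F: "translation_bounded B F"
  shows "(\<integral>\<^sup>+s. ennreal (norm (blinfun_apply (R s) (F (t - s)))) \<partial>lebesgue_on {0..}) < \<infinity>"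
proof -
  have "(\<integral>\<^sup>+s. ennreal (norm (blinfun_apply (R s) (F (t - s)))) \<partial>lebesgue_on {0..})
    \<le> (\<Sum>j. weight j * L01 (hat F (t - real j - 1)))"
    using F by (intro nn_integral_conv_le) (simp add: translation_bounded_def)
  also have "\<dots> \<le> (\<Sum>j. weight j * ennreal B)"
    using F by (intro suminf_le summableI mult_left_mono) (auto simp: translation_bounded_def)
  also have "\<dots> = (\<Sum>j. weight j) * ennreal B" by simp
  also have "\<dots> < \<infinity>" using weight_summable by (simp add: ennreal_mult_less_top)
  finally show ?thesis .
qed

lemma has_bochner_conv:
  assumes F: "translation_bounded B F"
  shows "has_bochner (lebesgue_on {0..}) (\<lambda>s. blinfun_apply (R s) (F (t - s))) (conv F t)"
proof -
  have M: "complete_measure (lebesgue_on {0::real..})" by (rule complete_lebesgue_on) simp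
  have "\<exists>y. has_bochner (lebesgue_on {0..}) (\<lambda>s. blinfun_apply (R s) (F (t - s))) y"
    using F by (intro has_bochner_exists[OF M _ nn_integral_conv_finite[OF F]]
        strongly_measurable_blinfun_apply[OF R_cont] strongly_measurable_reflect)
      (simp add: translation_bounded_def)
  then show ?thesis unfolding conv_def using bochner_integral_eq[OF M] by metis
qed

text \<open>The key estimate. By complex linearity the difference of the two convolutions is the
  convolution of \<open>x \<mapsto> F (x + (t' - t)) - c G x\<close> at \<open>t\<close>.\<close>

lemma norm_conv_diff_le:
  assumes F: "translation_bounded B F" and G: "translation_bounded C G"
  shows "ennreal (norm (conv F t' - c *\<^sub>C conv G t)) \<le>
    (\<Sum>j. weight j * L01 (hat F (t' - real j - 1) - c *\<^sub>C hat G (t - real j - 1)))"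
proof -
  have M: "complete_measure (lebesgue_on {0::real..})" by (rule complete_lebesgue_on) simp
  define W where "W x = F ((t' - t) + x) - c *\<^sub>C G x" for x
  have W: "strongly_measurable lebesgue W"
    unfolding W_def using F G
    by (intro strongly_measurable_diff strongly_measurable_scaleC strongly_measurable_shift)
      (auto simp: translation_bounded_def)
  have "has_bochner (lebesgue_on {0..}) (\<lambda>s. blinfun_apply (R s) (F (t' - s)) - c *\<^sub>C blinfun_apply (R s) (G (t - s)))
      (conv F t' - c *\<^sub>C conv G t)"
    by (intro has_bochner_diff[OF M] has_bochner_bounded_linear[OF M _ bounded_linear_scaleC]
        has_bochner_conv[OF F] has_bochner_conv[OF G])
  then have "has_bochner (lebesgue_on {0..}) (\<lambda>s. blinfun_apply (R s) (W (t - s))) (conv F t' - c *\<^sub>C conv G t)"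
  proof (rule has_bochner_AE_cong)
    \<comment> \<open>Linearity of \<open>R 0\<close> is not assumed over the complex numbers, so the point \<open>0\<close> is discarded.\<close>
    have "AE s in lebesgue_on {0..}. s \<noteq> (0::real)"
      by (rule AE_I'[of "{0}"]) (auto simp: null_sets_restrict_space)
    then show "AE s in lebesgue_on {0..}. blinfun_apply (R s) (F (t' - s)) - c *\<^sub>C blinfun_apply (R s) (G (t - s)) =
        blinfun_apply (R s) (W (t - s))"
      using AE_space
    proof eventually_elim
      case (elim s)
      then have "0 < s" by simp
      from R_linear[OF this] show ?case by (simp add: W_def complex_linear_def blinfun.diff_right)
    qed
  qed
  from has_bochner_norm_le[OF M this] nn_integral_conv_le[OF W, of t]
  have "ennreal (norm (conv F t' - c *\<^sub>C conv G t)) \<le> (\<Sum>j. weight j * L01 (hat W (t - real j - 1)))"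
    by (rule order_trans)
  moreover have "hat W (t - real j - 1) = hat F (t' - real j - 1) - c *\<^sub>C hat G (t - real j - 1)" for j
    by (auto simp: hat_def W_def fun_eq_iff scaleC_fun_def algebra_simps)
  ultimately show ?thesis by simp
qed

lemma L01_diff_le:
  assumes F: "strongly_measurable lebesgue F" "L01 (hat F x) \<le> ennreal B" "0 \<le> B"
    and G: "strongly_measurable lebesgue G" "L01 (hat G y) \<le> ennreal C" "0 \<le> C"
  shows "L01 (hat F x - c *\<^sub>C hat G y) \<le> ennreal (4 * (B + cmod c * C))"
proof -
  note m = borel_measurable_norm_hat[OF F(1)] borel_measurable_norm_hat[OF G(1)]
  have "(\<lambda>s. norm ((c *\<^sub>C hat G y) s)) \<in> borel_measurable (lebesgue_on {0..1})"
    unfolding scaleC_fun_def norm_scaleC by (intro borel_measurable_times m) simp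
  then have "L01 (hat F x - c *\<^sub>C hat G y) \<le> 4 * (L01 (hat F x) + L01 (c *\<^sub>C hat G y))"
    using m by (intro eLp_norm_dominated_sum[OF q]) (auto intro: norm_triangle_ineq4)
  also have "\<dots> \<le> 4 * (ennreal B + ennreal (cmod c * C))"
    by (intro mult_left_mono add_mono eLp_norm_scaleC[OF q] F G m) simp
  also have "\<dots> = ennreal (4 * (B + cmod c * C))"
  proof -
    have "0 \<le> cmod c * C" using G by simp
    then have "ennreal B + ennreal (cmod c * C) = ennreal (B + cmod c * C)"
      using F by (intro ennreal_plus[symmetric])
    then show ?thesis
      using \<open>0 \<le> cmod c * C\<close> F by (metis add_nonneg_nonneg ennreal_mult'' ennreal_numeral)
  qed
  finally show ?thesis .
qed

lemma norm_conv_diff_le_const: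
  assumes F: "translation_bounded B F" and G: "translation_bounded C G" and e: "0 \<le> e"
    and le: "\<And>x. L01 (hat F (x + p) - c *\<^sub>C hat G x) \<le> ennreal e"
  shows "norm (conv F (t + p) - c *\<^sub>C conv G t) \<le> enn2real (\<Sum>j. weight j) * e"
proof -
  have "ennreal (norm (conv F (t + p) - c *\<^sub>C conv G t)) \<le>
      (\<Sum>j. weight j * L01 (hat F (t + p - real j - 1) - c *\<^sub>C hat G (t - real j - 1)))"
    by (rule norm_conv_diff_le[OF F G])
  also have "\<dots> \<le> (\<Sum>j. weight j * ennreal e)"
  proof (intro suminf_le summableI mult_left_mono)
    fix j show "L01 (hat F (t + p - real j - 1) - c *\<^sub>C hat G (t - real j - 1)) \<le> ennreal e"
      using le[of "t - real j - 1"] by (simp add: algebra_simps)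
  qed simp
  also have "\<dots> = (\<Sum>j. weight j) * ennreal e" by simp
  also have "\<dots> = ennreal (enn2real (\<Sum>j. weight j) * e)"
    using weight_summable e by (simp add: ennreal_mult less_top)
  finally show ?thesis using e by (simp add: ennreal_le_iff)
qed

text \<open>The case \<open>c = 0\<close> of the key estimate.\<close>

lemma conv_bounded:
  assumes F: "translation_bounded B F"
  shows "norm (conv F t) \<le> enn2real (\<Sum>j. weight j) * (4 * B)"
proof -
  have "norm (conv F (t + 0) - 0 *\<^sub>C conv F t) \<le> enn2real (\<Sum>j. weight j) * (4 * (B + cmod 0 * B))"
    using F by (intro norm_conv_diff_le_const[OF F F] L01_diff_le) (auto simp: translation_bounded_def)
  moreover have "0 *\<^sub>C conv F t = 0" using norm_scaleC[of 0 "conv F t"] by simp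
  ultimately show ?thesis by simp
qed

lemma conv_tendsto:
  assumes F: "translation_bounded B F" and G: "translation_bounded C G"
    and lim: "\<And>j. ((\<lambda>l. L01 (hat F (u l - real j - 1) - hat G (v l - real j - 1))) \<longlongrightarrow> 0) L"
  shows "((\<lambda>l. conv F (u l) - conv G (v l)) \<longlongrightarrow> 0) L"
proof -
  have "((\<lambda>l. \<Sum>j. weight j * L01 (hat F (u l - real j - 1) - hat G (v l - real j - 1))) \<longlongrightarrow> 0) L"
  proof (rule tendsto_suminf_ennreal_0[OF weight_summable _ lim])
    show "L01 (hat F (u l - real j - 1) - hat G (v l - real j - 1)) \<le> ennreal (4 * (B + cmod 1 * C))" for l j
      using F G L01_diff_le[of F _ B G _ C 1] by (simp add: translation_bounded_def scaleC_one)
  qed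
  then have "((\<lambda>l. ennreal (norm (conv F (u l) - conv G (v l)))) \<longlongrightarrow> 0) L"
  proof (rule tendsto_sandwich[OF _ _ tendsto_const, rotated -1])
    show "\<forall>\<^sub>F l in L. ennreal (norm (conv F (u l) - conv G (v l)))
        \<le> (\<Sum>j. weight j * L01 (hat F (u l - real j - 1) - hat G (v l - real j - 1)))"
      using norm_conv_diff_le[OF F G, where c=1] by (simp add: scaleC_one)
  qed simp
  then have "((\<lambda>l. norm (conv F (u l) - conv G (v l))) \<longlongrightarrow> 0) L"
    using tendsto_ennreal_iff[of "\<lambda>l. norm (conv F (u l) - conv G (v l))" L 0] by simp
  then show ?thesis by (rule tendsto_norm_zero_cancel)
qed

lemma conv_continuous:
  assumes F: "translation_bounded B F"
    and cont: "\<And>x. ((\<lambda>y. L01 (hat F y - hat F x)) \<longlongrightarrow> 0) (at x)"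
  shows "continuous_on UNIV (conv F)"
  unfolding continuous_on_def
proof
  fix t
  have "((\<lambda>y. conv F y - conv F t) \<longlongrightarrow> 0) (at t)"
  proof (rule conv_tendsto[OF F F])
    fix j
    have "((\<lambda>h. L01 (hat F ((t - real j - 1) + h) - hat F (t - real j - 1))) \<longlongrightarrow> 0) (at 0)"
      using cont[of "t - real j - 1"] by (rule LIM_offset_zero)
    from LIM_offset[OF this, of "-t"]
    show "((\<lambda>y. L01 (hat F (y - real j - 1) - hat F (t - real j - 1))) \<longlongrightarrow> 0) (at t)"
      by (simp add: algebra_simps)
  qed
  then show "(conv F \<longlongrightarrow> conv F t) (at t)" by (rule LIM_zero_cancel)
qed

end

section \<open>Stepanov continuity of a function cut off at the origin\<close>

lemma nn_integral_unit_shift: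
  fixes v :: "real \<Rightarrow> ennreal"
  assumes v: "v \<in> borel_measurable lebesgue"
  shows "(\<integral>\<^sup>+s. v (x + s) \<partial>lebesgue_on {0..1}) = (\<integral>\<^sup>+u. v u * indicator {x..x+1} u \<partial>lebesgue)"
proof -
  have "(\<lambda>u. v u * indicator {x..x+1} u) \<in> borel_measurable lebesgue"
    by (intro borel_measurable_times_ennreal v borel_measurable_indicator) simp
  then have "(\<integral>\<^sup>+u. v u * indicator {x..x+1} u \<partial>lebesgue) = (\<integral>\<^sup>+s. v (x + s) * indicator {x..x+1} (x + s) \<partial>lebesgue)"
    using nn_integral_distr[OF distr_shift_lebesgue(2)[of x], of "\<lambda>u. v u * indicator {x..x+1} u"] distr_shift_lebesgue(1)[of x] by simp
  also have "\<dots> = (\<integral>\<^sup>+s. v (x + s) * indicator {0..1} s \<partial>lebesgue)"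
    by (intro nn_integral_cong) (auto simp: indicator_def)
  finally show ?thesis by (simp add: nn_integral_restrict_space)
qed

text \<open>Absolute continuity of the integral, for the intervals \<open>[0, d]\<close> that shrink to a point.\<close>

lemma nn_integral_small_near_0:
  fixes w :: "real \<Rightarrow> ennreal"
  assumes w: "w \<in> borel_measurable lebesgue" and fin: "(\<integral>\<^sup>+u. w u * indicator {0..1} u \<partial>lebesgue) < \<infinity>"
    and \<eta>: "0 < \<eta>"
  shows "\<exists>d>0. (\<integral>\<^sup>+u. w u * indicator {0..d} u \<partial>lebesgue) \<le> ennreal \<eta>"
proof -
  have "(\<lambda>n. \<integral>\<^sup>+u. w u * indicator {0..1 / real (Suc n)} u \<partial>lebesgue) \<longlonglongrightarrow> (\<integral>\<^sup>+u. w u * indicator {0} u \<partial>lebesgue)"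
  proof (rule nn_integral_dominated_convergence[where w="\<lambda>u. w u * indicator {0..1} u"])
    show "AE u in lebesgue. w u * indicator {0..1 / real (Suc n)} u \<le> w u * indicator {0..1} u" for n
    proof (rule AE_I2)
      fix u :: real
      have "1 / real (Suc n) \<le> 1" by simp
      then show "w u * indicator {0..1 / real (Suc n)} u \<le> w u * indicator {0..1} u"
        by (intro mult_left_mono) (auto simp: indicator_def simp del: of_nat_Suc intro: order_trans)
    qed
    show "AE u in lebesgue. (\<lambda>n. w u * indicator {0..1 / real (Suc n)} u) \<longlonglongrightarrow> w u * indicator {0} u"
    proof (rule AE_I2)
      fix u :: real
      show "(\<lambda>n. w u * indicator {0..1 / real (Suc n)} u) \<longlonglongrightarrow> w u * indicator {0} u"
      proof (cases "u > 0")
        case True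
        have "\<forall>\<^sub>F n in sequentially. 1 / real (Suc n) < u"
          using order_tendstoD(2)[OF LIMSEQ_Suc[OF lim_1_over_n] True] by simp
        then have "\<forall>\<^sub>F n in sequentially. w u * indicator {0} u = w u * indicator {0..1 / real (Suc n)} u"
          by eventually_elim (use True in \<open>auto simp: indicator_def simp del: of_nat_Suc\<close>)
        then show ?thesis by (rule Lim_transform_eventually[OF tendsto_const])
      next
        case False
        then have "w u * indicator {0..1 / real (Suc n)} u = w u * indicator {0} u" for n
          by (auto simp: indicator_def)
        then show ?thesis by simp
      qed
    qed
  qed (use fin in \<open>auto intro!: borel_measurable_times_ennreal w borel_measurable_indicator\<close>)
  moreover have "(\<integral>\<^sup>+u. w u * indicator {0} u \<partial>lebesgue) = (\<integral>\<^sup>+u. 0 \<partial>(lebesgue :: real measure))"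
    by (rule nn_integral_cong_AE, rule AE_I'[of "{0}"]) (auto simp: indicator_def)
  ultimately have "(\<lambda>n. \<integral>\<^sup>+u. w u * indicator {0..1 / real (Suc n)} u \<partial>lebesgue) \<longlonglongrightarrow> 0" by simp
  from order_tendstoD(2)[OF this, of "ennreal \<eta>"] \<eta>
  obtain n where "(\<integral>\<^sup>+u. w u * indicator {0..1 / real (Suc n)} u \<partial>lebesgue) < ennreal \<eta>"
    by (auto simp: eventually_sequentially)
  then show ?thesis by (intro exI[of _ "1 / real (Suc n)"]) simp
qed

lemma borel_measurable_norm_powr:
  "strongly_measurable lebesgue F \<Longrightarrow> (\<lambda>s. ennreal (norm (F s) powr q)) \<in> borel_measurable lebesgue"
  using borel_measurable_norm_strongly_measurable[OF completion.complete_measure_axioms, of lborel F]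
  by measurable

lemma eLp_norm_hat_le_pos_part:
  assumes q: "1 \<le> q" and F: "strongly_measurable lebesgue F" and neg: "\<And>u. u < 0 \<Longrightarrow> F u = 0"
  shows "eLp_norm (ennreal q) (lebesgue_on {0..1}) (hat F x) \<le> eLp_norm (ennreal q) (lebesgue_on {0..1}) (hat F (max 0 x))"
proof (rule eLp_norm_le_if_nn_integral_le[OF q])
  note s = nn_integral_unit_shift[OF borel_measurable_norm_powr[OF F]]
  show "(\<integral>\<^sup>+s. ennreal (norm (hat F x s) powr q) \<partial>lebesgue_on {0..1}) \<le> (\<integral>\<^sup>+s. ennreal (norm (hat F (max 0 x) s) powr q) \<partial>lebesgue_on {0..1})"
    unfolding hat_def s by (intro nn_integral_mono) (auto simp: indicator_def max_def neg not_less)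
qed

text \<open>For \<open>F\<close> supported in \<open>[0, \<infinity>)\<close>, the values \<open>F(u + \<delta>) - F(u)\<close> with \<open>u \<ge> 0\<close> are seen by the
  translates at nonnegative arguments, and those with \<open>u < 0\<close> reduce to \<open>F(u + \<delta>)\<close>, which is
  nonzero only if \<open>u + \<delta>\<close> lies in \<open>[0, \<delta>]\<close>.\<close>

lemma nn_integral_truncated_diff_le:
  assumes q: "1 \<le> q" and F: "strongly_measurable lebesgue F" and neg: "\<And>u. u < 0 \<Longrightarrow> F u = 0" and \<delta>: "0 \<le> \<delta>"
  shows "(\<integral>\<^sup>+s. ennreal (norm ((hat F (x + \<delta>) - hat F x) s) powr q) \<partial>lebesgue_on {0..1}) \<le>
     (\<integral>\<^sup>+s. ennreal (norm ((hat F (max 0 x + \<delta>) - hat F (max 0 x)) s) powr q) \<partial>lebesgue_on {0..1}) +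
     (\<integral>\<^sup>+u. ennreal (norm (F u) powr q) * indicator {0..\<delta>} u \<partial>lebesgue)"
proof -
  define D where "D u = F (\<delta> + u) - F u" for u
  have D: "strongly_measurable lebesgue D"
    unfolding D_def by (intro strongly_measurable_diff strongly_measurable_shift F)
  note s = nn_integral_unit_shift[OF borel_measurable_norm_powr[OF D]]
  have hD: "(hat F (y + \<delta>) - hat F y) s = D (y + s)" for y s by (simp add: hat_def D_def algebra_simps)
  have m1: "(\<lambda>u. ennreal (norm (F u) powr q) * indicator {0..\<delta>} u) \<in> borel_measurable lebesgue"
    by (intro borel_measurable_times_ennreal borel_measurable_norm_powr[OF F] borel_measurable_indicator) simp
  have m2: "(\<lambda>u. ennreal (norm (D u) powr q) * indicator {max 0 x..max 0 x + 1} u) \<in> borel_measurable lebesgue"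
    by (intro borel_measurable_times_ennreal borel_measurable_norm_powr[OF D] borel_measurable_indicator) simp
  have "(\<integral>\<^sup>+s. ennreal (norm (D (x + s)) powr q) \<partial>lebesgue_on {0..1}) \<le>
     (\<integral>\<^sup>+u. ennreal (norm (D u) powr q) * indicator {max 0 x..max 0 x + 1} u +
        ennreal (norm (F (\<delta> + u)) powr q) * indicator {0..\<delta>} (\<delta> + u) \<partial>lebesgue)"
    unfolding s
  proof (rule nn_integral_mono)
    fix u
    show "ennreal (norm (D u) powr q) * indicator {x..x + 1} u \<le>
      ennreal (norm (D u) powr q) * indicator {max 0 x..max 0 x + 1} u +
        ennreal (norm (F (\<delta> + u)) powr q) * indicator {0..\<delta>} (\<delta> + u)"
    proof (cases "u < 0")
      case True
      then have "D u = F (\<delta> + u)" by (simp add: D_def neg)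
      moreover have "\<delta> + u < 0 \<or> \<delta> + u \<in> {0..\<delta>}" using True by auto
      ultimately show ?thesis by (auto simp: indicator_def neg)
    next
      case False
      then show ?thesis by (auto simp: indicator_def max_def)
    qed
  qed
  also have "\<dots> = (\<integral>\<^sup>+u. ennreal (norm (D u) powr q) * indicator {max 0 x..max 0 x + 1} u \<partial>lebesgue) +
       (\<integral>\<^sup>+u. ennreal (norm (F (\<delta> + u)) powr q) * indicator {0..\<delta>} (\<delta> + u) \<partial>lebesgue)"
    by (rule nn_integral_add[OF m2 measurable_compose[OF distr_shift_lebesgue(2) m1]])
  also have "(\<integral>\<^sup>+u. ennreal (norm (F (\<delta> + u)) powr q) * indicator {0..\<delta>} (\<delta> + u) \<partial>lebesgue) =
      (\<integral>\<^sup>+u. ennreal (norm (F u) powr q) * indicator {0..\<delta>} u \<partial>lebesgue)"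
    using nn_integral_distr[OF distr_shift_lebesgue(2)[of \<delta>], of "\<lambda>u. ennreal (norm (F u) powr q) * indicator {0..\<delta>} u"]
      distr_shift_lebesgue(1)[of \<delta>] m1 by simp
  also have "(\<integral>\<^sup>+u. ennreal (norm (D u) powr q) * indicator {max 0 x..max 0 x + 1} u \<partial>lebesgue) =
     (\<integral>\<^sup>+s. ennreal (norm (D (max 0 x + s)) powr q) \<partial>lebesgue_on {0..1})"
    by (rule s[symmetric])
  finally show ?thesis unfolding hD .
qed

lemma eLp_norm_hat_diff_triangle:
  assumes q: "1 \<le> q" and F: "strongly_measurable lebesgue F"
    and G: "strongly_measurable lebesgue G" and W: "strongly_measurable lebesgue W"
  shows "eLp_norm (ennreal q) (lebesgue_on {0..1}) (hat F x - hat G y) \<le>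
    4 * (eLp_norm (ennreal q) (lebesgue_on {0..1}) (hat F x - hat W z) + eLp_norm (ennreal q) (lebesgue_on {0..1}) (hat G y - hat W z))"
proof (rule eLp_norm_dominated_sum[OF q])
  have m: "(\<lambda>s. norm ((hat A a - hat B b) s)) \<in> borel_measurable (lebesgue_on {0..1})"
    if "strongly_measurable lebesgue A" "strongly_measurable lebesgue B" for A B :: "real \<Rightarrow> 'a" and a b
    unfolding fun_diff_def using that
    by (intro borel_measurable_norm_strongly_measurable complete_lebesgue_on strongly_measurable_diff strongly_measurable_hat) auto
  show "(\<lambda>s. norm ((hat F x - hat W z) s)) \<in> borel_measurable (lebesgue_on {0..1})"
    "(\<lambda>s. norm ((hat G y - hat W z) s)) \<in> borel_measurable (lebesgue_on {0..1})"
    by (intro m F G W)+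
  show "norm ((hat F x - hat G y) s) \<le> norm ((hat F x - hat W z) s) + norm ((hat G y - hat W z) s)" for s
    using norm_triangle_ineq4[of "hat F x s - hat W z s" "hat G y s - hat W z s"] by simp
qed

lemma eLp_norm_minus_commute:
  "1 \<le> q \<Longrightarrow> eLp_norm (ennreal q) M (f - g) = eLp_norm (ennreal q) M (g - f)"
  by (rule eLp_norm_cong) (simp_all add: norm_minus_commute)

text \<open>The increment of the translates of \<open>F\<close> splits into an increment between two nonnegative
  arguments close to \<open>max 0 x\<close>, small by hypothesis, and the mass of \<open>\<parallel>F\<parallel>\<^sup>q\<close> on a short
  interval \<open>[0, \<delta>]\<close>.\<close>

lemma hat_truncated_continuous:
  fixes F :: "real \<Rightarrow> 'a::real_normed_vector"
  assumes q: "1 \<le> q" and F: "strongly_measurable lebesgue F" and neg: "\<And>u. u < 0 \<Longrightarrow> F u = 0"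
    and fin: "eLp_norm (ennreal q) (lebesgue_on {0..1}) (hat F 0) < \<infinity>"
    and cont: "\<And>t. 0 \<le> t \<Longrightarrow> ((\<lambda>s. eLp_norm (ennreal q) (lebesgue_on {0..1}) (hat F s - hat F t)) \<longlongrightarrow> 0) (at t within {0..})"
  shows "((\<lambda>y. eLp_norm (ennreal q) (lebesgue_on {0..1}) (hat F y - hat F x)) \<longlongrightarrow> 0) (at x)"
proof -
  let ?N = "\<lambda>f. eLp_norm (ennreal q) (lebesgue_on {0..1}) (f :: real \<Rightarrow> 'a)"
  let ?J = "\<lambda>f. \<integral>\<^sup>+s. ennreal (norm ((f :: real \<Rightarrow> 'a) s) powr q) \<partial>lebesgue_on {0..1}"
  define c0 where "c0 = max 0 x"
  have ex: "\<exists>d>0. \<forall>y. \<bar>y - x\<bar> < d \<longrightarrow> ?N (hat F y - hat F x) \<le> ennreal \<epsilon>" if \<epsilon>: "0 < \<epsilon>" for \<epsilon>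
  proof -
    define \<eta> where "\<eta> = \<epsilon> powr q / 2"
    have \<eta>: "0 < \<eta>" using \<epsilon> by (simp add: \<eta>_def)
    have "?J (hat F 0) < \<infinity>"
    proof -
      from fin obtain b where "0 \<le> b" "?N (hat F 0) = ennreal b" by (cases "?N (hat F 0)") auto
      from nn_integral_powr_eq_eLp_norm[OF q this(2,1)] show ?thesis by simp
    qed
    then have "(\<integral>\<^sup>+u. ennreal (norm (F u) powr q) * indicator {0..1} u \<partial>lebesgue) < \<infinity>"
      by (simp add: hat_def nn_integral_restrict_space)
    from nn_integral_small_near_0[OF borel_measurable_norm_powr[OF F] this \<eta>]
    obtain d1 where d1: "0 < d1" "(\<integral>\<^sup>+u. ennreal (norm (F u) powr q) * indicator {0..d1} u \<partial>lebesgue) \<le> ennreal \<eta>"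
      by blast
    \<comment> \<open>The triangle inequality with constant \<open>4\<close> is used for two terms below \<open>e\<close>, which loses \<open>8\<close>.\<close>
    define e where "e = \<eta> powr (1/q) / 8"
    have e: "0 < e" using \<eta> by (simp add: e_def)
    have "\<forall>\<^sub>F s in at c0 within {0..}. ?N (hat F s - hat F c0) < ennreal e"
      using e by (intro order_tendstoD(2)[OF cont]) (auto simp: c0_def)
    then obtain d2 where d2: "0 < d2" "\<And>s. 0 \<le> s \<Longrightarrow> s \<noteq> c0 \<Longrightarrow> dist s c0 < d2 \<Longrightarrow> ?N (hat F s - hat F c0) < ennreal e"
      unfolding eventually_at by auto
    have near: "?N (hat F s - hat F c0) \<le> ennreal e" if "0 \<le> s" "\<bar>s - c0\<bar> < d2" for s
    proof (cases "s = c0")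
      case True
      then show ?thesis using eLp_norm_zero[OF q, of "lebesgue_on {0..1}" "hat F s - hat F c0"] by simp
    next
      case False
      then show ?thesis using d2(2)[OF that(1)] that by (simp add: dist_real_def less_imp_le)
    qed
    have step: "?N (hat F (z + \<delta>) - hat F z) \<le> ennreal \<epsilon>"
      if z: "0 \<le> \<delta>" "\<delta> < d1" "\<delta> < d2" "z = x \<or> z + \<delta> = x" for z \<delta>
    proof -
      define p where "p = max 0 z"
      have p: "0 \<le> p" "\<bar>p - c0\<bar> < d2" "0 \<le> p + \<delta>" "\<bar>p + \<delta> - c0\<bar> < d2"
        using z by (auto simp: p_def c0_def)
      have "?N (hat F (p + \<delta>) - hat F p) \<le> 4 * (?N (hat F (p + \<delta>) - hat F c0) + ?N (hat F p - hat F c0))"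
        by (rule eLp_norm_hat_diff_triangle[OF q F F F])
      also have "\<dots> \<le> 4 * (ennreal e + ennreal e)"
        using p by (intro mult_left_mono add_mono near) auto
      also have "\<dots> = ennreal (\<eta> powr (1/q))"
      proof -
        have "ennreal e + ennreal e = ennreal (e + e)" using e by (intro ennreal_plus[symmetric]) auto
        moreover have "4 * ennreal (e + e) = ennreal (4 * (e + e))"
          using e by (subst ennreal_mult) auto
        ultimately show ?thesis by (simp add: e_def)
      qed
      finally have J1: "?J (hat F (p + \<delta>) - hat F p) \<le> ennreal \<eta>"
        using \<eta> q by (subst (asm) eLp_norm_le_iff[OF q]) (auto simp: powr_powr)
      have "?J (hat F (z + \<delta>) - hat F z) \<le> ?J (hat F (p + \<delta>) - hat F p) + (\<integral>\<^sup>+u. ennreal (norm (F u) powr q) * indicator {0..\<delta>} u \<partial>lebesgue)"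
        unfolding p_def by (rule nn_integral_truncated_diff_le[OF q F neg z(1)])
      also have "\<dots> \<le> ennreal \<eta> + (\<integral>\<^sup>+u. ennreal (norm (F u) powr q) * indicator {0..d1} u \<partial>lebesgue)"
        using z by (intro add_mono J1 nn_integral_mono mult_left_mono) (auto simp: indicator_def)
      also have "\<dots> \<le> ennreal \<eta> + ennreal \<eta>" by (intro add_mono d1) simp
      also have "\<dots> = ennreal (\<epsilon> powr q)" using \<eta> by (simp add: \<eta>_def flip: ennreal_plus)
      finally show ?thesis using \<epsilon> by (simp add: eLp_norm_le_iff[OF q])
    qed
    show ?thesis
    proof (intro exI[of _ "min d1 d2"] conjI allI impI)
      fix y assume y: "\<bar>y - x\<bar> < min d1 d2"
      show "?N (hat F y - hat F x) \<le> ennreal \<epsilon>"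
      proof (cases "x \<le> y")
        case True
        then show ?thesis using step[of "y - x" x] y by simp
      next
        case False
        then show ?thesis using step[of "x - y" y] y eLp_norm_minus_commute[OF q, of "lebesgue_on {0..1}" "hat F y"] by simp
      qed
    qed (use d1 d2 in simp)
  qed
  show ?thesis
  proof (rule order_tendstoI)
    fix a :: ennreal assume "0 < a"
    then obtain \<epsilon>' where "0 < \<epsilon>'" "\<epsilon>' < a" using dense by blast
    then obtain \<epsilon> where \<epsilon>: "0 < \<epsilon>" "ennreal \<epsilon> < a" by (cases \<epsilon>') auto
    from ex[OF \<epsilon>(1)] obtain d where "0 < d" "\<And>y. \<bar>y - x\<bar> < d \<Longrightarrow> ?N (hat F y - hat F x) \<le> ennreal \<epsilon>" by blast
    then show "\<forall>\<^sub>F y in at x. ?N (hat F y - hat F x) < a"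
      unfolding eventually_at using \<epsilon>(2) by (intro exI[of _ d]) (auto simp: dist_real_def intro: le_less_trans)
  qed simp
qed

section \<open>Bounded continuous functions and their translates\<close>

lemma Lp_loc_strongly_measurable:
  assumes F: "F \<in> Lp_loc p I" and I: "closed I"
  shows "strongly_measurable (lebesgue_on I) F"
proof (rule strongly_measurable_countable_cover[where A="\<lambda>n. I \<inter> {- real n..real n}"])
  have Im: "I \<in> sets lebesgue" using I by auto
  fix n :: nat
  have "compact (I \<inter> {- real n..real n})" using I by (intro closed_Int_compact) auto
  then have "strongly_measurable (lebesgue_on (I \<inter> {- real n..real n})) F"
    using F by (simp add: Lp_loc_def Lp_space_def)
  moreover have "restrict_space (lebesgue_on I) (I \<inter> {- real n..real n}) = lebesgue_on (I \<inter> {- real n..real n})"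
    using Im by (subst restrict_restrict_space) (auto simp: Int_absorb1 inf.absorb2)
  ultimately show "strongly_measurable (restrict_space (lebesgue_on I) (I \<inter> {- real n..real n})) F" by simp
  show "I \<inter> {- real n..real n} \<in> sets (lebesgue_on I)"
    using Im by (subst sets_restrict_space_iff) auto
next
  show "space (lebesgue_on I) \<subseteq> (\<Union>n. I \<inter> {- real n..real n})"
  proof
    fix x assume "x \<in> space (lebesgue_on I)"
    moreover obtain n where "\<bar>x\<bar> \<le> real n" using real_arch_simple by blast
    ultimately show "x \<in> (\<Union>n. I \<inter> {- real n..real n})" by (auto intro!: exI[of _ n])
  qed
qed

lemma eventually_within_in: "\<forall>\<^sub>F s in at t within I. s \<in> I"
  by (simp add: eventually_at_filter)

text \<open>Passing from the real seminorm to the extended norm. The seminorm is \<open>enn2real\<close> of the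
  extended norm, hence \<open>0\<close> when the latter is infinite, so finiteness has to be checked first;
  it comes from membership of the translates in \<open>L\<^sup>q\<close>.\<close>

lemma C_b_hatD:
  fixes F :: "real \<Rightarrow> 'a::complex_normed_vector"
  assumes q: "1 \<le> q" and F: "hat F \<in> C_b (Lq01 q) (Lq01_norm q) I"
  obtains B where "0 \<le> B" "\<And>t. t \<in> I \<Longrightarrow> eLp_norm (ennreal q) (lebesgue_on {0..1}) (hat F t) \<le> ennreal B"
    "\<And>t. t \<in> I \<Longrightarrow> ((\<lambda>s. eLp_norm (ennreal q) (lebesgue_on {0..1}) (hat F s - hat F t)) \<longlongrightarrow> 0) (at t within I)"
proof -
  let ?N = "\<lambda>f. eLp_norm (ennreal q) (lebesgue_on {0..1}) (f :: real \<Rightarrow> 'a)"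
  obtain B where B: "\<And>t. t \<in> I \<Longrightarrow> Lq01_norm q (hat F t) \<le> B" using F by (auto simp: C_b_def)
  have m: "strongly_measurable (lebesgue_on {0..1}) (hat F t)" "?N (hat F t) < \<infinity>" if "t \<in> I" for t
    using F that by (auto simp: C_b_def Lp_space_def)
  have "?N (hat F t) \<le> ennreal \<bar>B\<bar>" if "t \<in> I" for t
  proof -
    have "?N (hat F t) = ennreal (Lq01_norm q (hat F t))" using m[OF that] by (simp add: Lp_norm_def less_top)
    then show ?thesis using B[OF that] by (auto intro: ennreal_leI)
  qed
  moreover have "((\<lambda>s. ?N (hat F s - hat F t)) \<longlongrightarrow> 0) (at t within I)" if t: "t \<in> I" for t
  proof -
    have "((\<lambda>s. ennreal (Lq01_norm q (hat F s - hat F t))) \<longlongrightarrow> 0) (at t within I)"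
      using F t tendsto_ennrealI by (fastforce simp: C_b_def)
    moreover have "\<forall>\<^sub>F s in at t within I. ennreal (Lq01_norm q (hat F s - hat F t)) = ?N (hat F s - hat F t)"
    proof (rule eventually_mono[OF eventually_within_in])
      fix s assume s: "s \<in> I"
      have "?N (hat F s - hat F t) \<le> 4 * (?N (hat F s) + ?N (hat F t))"
        using s t by (intro eLp_norm_dominated_sum[OF q] borel_measurable_norm_strongly_measurable complete_lebesgue_on m)
          (auto intro: norm_triangle_ineq4)
      also have "\<dots> < \<infinity>" using m(2)[OF s] m(2)[OF t] by (auto simp: ennreal_mult_less_top)
      finally show "ennreal (Lq01_norm q (hat F s - hat F t)) = ?N (hat F s - hat F t)"
        by (simp add: Lp_norm_def less_top)
    qed
    ultimately show ?thesis by (rule Lim_transform_eventually)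
  qed
  ultimately show thesis using that[of "\<bar>B\<bar>"] by simp
qed

lemma Lq01_norm_le:
  assumes q: "1 \<le> q" and b: "0 \<le> b" and f: "\<And>x. x \<in> {0..1} \<Longrightarrow> norm (f x) \<le> b"
  shows "Lq01_norm q f \<le> b"
proof -
  have "eLp_norm (ennreal q) (lebesgue_on {0..1}) f \<le> ennreal b"
    using emeasure_lebesgue_on_unit[of 0] f by (intro eLp_norm_le_bound[OF q b]) auto
  then show ?thesis unfolding Lp_norm_def by (rule enn2real_leI[OF b])
qed

lemma Lq01_norm_nonneg: "0 \<le> Lq01_norm q f" by (simp add: Lp_norm_def)

lemma Lq01_norm_cong:
  "1 \<le> q \<Longrightarrow> (\<And>x. x \<in> {0..1} \<Longrightarrow> f x = g x) \<Longrightarrow> Lq01_norm q f = Lq01_norm q g"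
  unfolding Lp_norm_def using eLp_norm_cong[of q "lebesgue_on {0..1}" f g] by simp

lemma hat_continuous_in_C_b:
  fixes u :: "real \<Rightarrow> 'a::complex_normed_vector"
  assumes q: "1 \<le> q" and u: "continuous_on UNIV u" and B: "\<And>x. norm (u x) \<le> B"
  shows "hat u \<in> C_b (Lq01 q) (Lq01_norm q) I"
  unfolding C_b_def
proof (intro CollectI conjI ballI)
  have B0: "0 \<le> B" using B[of 0] norm_ge_zero order_trans by blast
  fix t assume "t \<in> I"
  have "eLp_norm (ennreal q) (lebesgue_on {0..1}) (hat u t) \<le> ennreal B"
    using emeasure_lebesgue_on_unit[of 0] B by (intro eLp_norm_le_bound[OF q B0]) (auto simp: hat_def)
  then show "hat u t \<in> Lq01 q"
    using strongly_measurable_hat[OF strongly_measurable_continuous[OF u]] by (auto simp: Lp_space_def le_less_trans)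
  show "((\<lambda>s. Lq01_norm q (hat u s - hat u t)) \<longlongrightarrow> 0) (at t within I)"
  proof (rule tendstoI)
    fix e :: real assume e: "0 < e"
    have "uniformly_continuous_on {t - 1..t + 2} u"
      by (rule compact_uniformly_continuous[OF continuous_on_subset[OF u]]) auto
    then obtain d where d: "0 < d" "\<And>x y. x \<in> {t-1..t+2} \<Longrightarrow> y \<in> {t-1..t+2} \<Longrightarrow> dist y x < d \<Longrightarrow> dist (u y) (u x) < e / 2"
      unfolding uniformly_continuous_on_def using e by (meson half_gt_zero)
    have "dist (Lq01_norm q (hat u s - hat u t)) 0 < e" if "dist s t < min d 1" for s
    proof -
      have "Lq01_norm q (hat u s - hat u t) \<le> e / 2"
      proof (rule Lq01_norm_le[OF q])
        fix x :: real assume "x \<in> {0..1}"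
        then have "dist (u (s + x)) (u (t + x)) < e / 2"
          using that by (intro d(2)) (auto simp: dist_real_def)
        then show "norm ((hat u s - hat u t) x) \<le> e / 2" by (simp add: hat_def dist_norm)
      qed (use e in simp)
      then show ?thesis using e Lq01_norm_nonneg[of q "hat u s - hat u t"] by (simp add: dist_real_def)
    qed
    then show "\<forall>\<^sub>F s in at t within I. dist (Lq01_norm q (hat u s - hat u t)) 0 < e"
      unfolding eventually_at using d(1) by (intro exI[of _ "min d 1"]) auto
  qed
next
  have B0: "0 \<le> B" using B[of 0] norm_ge_zero order_trans by blast
  show "\<exists>B. \<forall>t\<in>I. Lq01_norm q (hat u t) \<le> B"
    using B by (intro exI[of _ B] ballI Lq01_norm_le[OF q B0]) (simp add: hat_def)
qed

lemma hat_C_b_cong: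
  fixes u v :: "real \<Rightarrow> 'a::complex_normed_vector"
  assumes q: "1 \<le> q" and u: "hat u \<in> C_b (Lq01 q) (Lq01_norm q) {0..}" and eq: "\<And>x. 0 \<le> x \<Longrightarrow> u x = v x"
  shows "hat v \<in> C_b (Lq01 q) (Lq01_norm q) {0..}"
proof -
  have h: "hat u t x = hat v t x" if "0 \<le> t" "x \<in> {0..1}" for t x using that eq by (simp add: hat_def)
  have N: "Lq01_norm q (hat u t) = Lq01_norm q (hat v t)" if "0 \<le> t" for t
    using h[OF that] by (intro Lq01_norm_cong[OF q])
  have ND: "Lq01_norm q (hat u s - hat u t) = Lq01_norm q (hat v s - hat v t)" if "0 \<le> t" "0 \<le> s" for s t
    using h that by (intro Lq01_norm_cong[OF q]) simp
  have V: "hat v t \<in> Lq01 q" if "0 \<le> t" for t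
  proof -
    have "hat u t \<in> Lq01 q" using u that by (simp add: C_b_def)
    moreover have "eLp_norm (ennreal q) (lebesgue_on {0..1}) (hat u t) = eLp_norm (ennreal q) (lebesgue_on {0..1}) (hat v t)"
      using h[OF that] by (intro eLp_norm_cong[OF q]) simp
    moreover have "AE x in lebesgue_on {0..1}. hat u t x = hat v t x"
      using h[OF that] by (intro AE_I2) simp
    ultimately show ?thesis using strongly_measurable_AE_cong by (auto simp: Lp_space_def)
  qed
  have "((\<lambda>s. Lq01_norm q (hat v s - hat v t)) \<longlongrightarrow> 0) (at t within {0..})" if t: "0 \<le> t" for t
  proof (rule Lim_transform_eventually)
    show "((\<lambda>s. Lq01_norm q (hat u s - hat u t)) \<longlongrightarrow> 0) (at t within {0..})" using u t by (simp add: C_b_def)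
    show "\<forall>\<^sub>F s in at t within {0..}. Lq01_norm q (hat u s - hat u t) = Lq01_norm q (hat v s - hat v t)"
      by (rule eventually_mono[OF eventually_within_in]) (simp add: ND t)
  qed
  then show ?thesis using u V N by (auto simp: C_b_def)
qed

lemma hat_continuous_in_C_0:
  fixes u :: "real \<Rightarrow> 'a::complex_normed_vector"
  assumes q: "1 \<le> q" and u: "continuous_on UNIV u" and B: "\<And>x. norm (u x) \<le> B" and lim: "(u \<longlongrightarrow> 0) at_top"
  shows "hat u \<in> C_0 (Lq01 q) (Lq01_norm q)"
  unfolding C_0_def
proof (intro CollectI conjI hat_continuous_in_C_b[OF q u B] tendstoI)
  fix e :: real assume e: "0 < e"
  have "\<forall>\<^sub>F t in at_top. dist (u t) 0 < e / 2" using tendstoD[OF lim, of "e / 2"] e by simp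
  then obtain T where T: "\<And>t. T \<le> t \<Longrightarrow> norm (u t) < e / 2" by (auto simp: eventually_at_top_linorder)
  have "dist (Lq01_norm q (hat u t)) 0 < e" if "T \<le> t" for t
  proof -
    have "Lq01_norm q (hat u t) \<le> e / 2"
      using T that e by (intro Lq01_norm_le[OF q]) (auto simp: hat_def less_imp_le)
    then show ?thesis using e Lq01_norm_nonneg[of q "hat u t"] by (simp add: dist_real_def)
  qed
  then show "\<forall>\<^sub>F t in at_top. dist (Lq01_norm q (hat u t)) 0 < e"
    by (auto simp: eventually_at_top_linorder)
qed

lemma stepanov_bounded_continuous:
  fixes u H :: "real \<Rightarrow> 'a::complex_normed_vector"
  assumes q: "1 \<le> q" and u: "continuous_on UNIV u" and B: "\<And>x. norm (u x) \<le> B"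
    and eq: "\<And>x. 0 \<le> x \<Longrightarrow> H x = u x"
  shows "stepanov_bounded q {0..} H"
proof -
  have B0: "0 \<le> B" using B[of 0] norm_ge_zero order_trans by blast
  have "H \<in> Lp_space (ennreal q) (lebesgue_on K)" if K: "compact K" "K \<subseteq> {0..}" for K
  proof -
    have Km: "K \<in> sets lebesgue" "emeasure lebesgue K < \<infinity>"
      using K(1) lmeasurable_compact[OF K(1)] by (auto simp: fmeasurable_def)
    have "strongly_measurable (lebesgue_on K) u"
      by (rule strongly_measurable_lebesgue_on[OF strongly_measurable_continuous[OF u] Km(1)])
    then have "strongly_measurable (lebesgue_on K) H"
      by (rule strongly_measurable_AE_cong) (use K eq in \<open>auto intro!: AE_I2\<close>)
    moreover have "eLp_norm (ennreal q) (lebesgue_on K) H < \<infinity>"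
    proof -
      have "(\<integral>\<^sup>+x. ennreal (norm (H x) powr q) \<partial>lebesgue_on K) \<le> (\<integral>\<^sup>+x. ennreal (B powr q) \<partial>lebesgue_on K)"
        using K B eq q by (intro nn_integral_mono ennreal_leI powr_mono2) auto
      also have "\<dots> = ennreal (B powr q) * emeasure lebesgue K"
        using Km by (simp add: emeasure_restrict_space)
      also have "\<dots> < \<infinity>" using Km by (simp add: ennreal_mult_less_top)
      finally show ?thesis unfolding eLp_norm_real[OF q] by (auto simp: ennreal_powr_def)
    qed
    ultimately show ?thesis by (simp add: Lp_space_def)
  qed
  moreover have "(SUP t\<in>{0..}. eLp_norm (ennreal q) (lebesgue_on {t..t+1}) H) \<le> ennreal B"
    using B eq by (intro SUP_least eLp_norm_le_bound[OF q B0] emeasure_lebesgue_on_unit) auto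
  then have "(SUP t\<in>{0..}. eLp_norm (ennreal q) (lebesgue_on {t..t+1}) H) < \<infinity>"
    by (rule le_less_trans) simp
  ultimately show ?thesis by (simp add: stepanov_bounded_def Lp_loc_def)
qed

section \<open>Asymptotics of the finite convolution\<close>

context summable_kernel
begin

lemma translation_bounded_and_continuous_if_C_b:
  assumes g: "strongly_measurable lebesgue g" and C: "hat g \<in> C_b (Lq01 q) (Lq01_norm q) UNIV"
  obtains B where "translation_bounded B g" "\<And>x. ((\<lambda>y. L01 (hat g y - hat g x)) \<longlongrightarrow> 0) (at x)"
  using C_b_hatD[OF q C] g that unfolding translation_bounded_def by (metis UNIV_I)

text \<open>An \<open>\<epsilon>\<close>-almost period of \<open>g\<close> with multiplier \<open>c\<close>, in the Stepanov sense, is an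
  almost period of the convolution in the supremum norm, hence also in the Stepanov sense, for
  the same multiplier and up to the factor \<open>\<Sum>\<^sub>j w\<^sub>j\<close>.\<close>

lemma conv_almost_period:
  assumes g: "strongly_measurable lebesgue g" and C: "hat g \<in> C_b (Lq01 q) (Lq01_norm q) UNIV"
    and le: "\<And>x. Lq01_norm q (hat g (x + p) - c *\<^sub>C hat g x) \<le> \<epsilon>" and \<epsilon>: "0 \<le> \<epsilon>"
  shows "Lq01_norm q (hat (conv g) (x + p) - c *\<^sub>C hat (conv g) x) \<le> enn2real (\<Sum>j. weight j) * \<epsilon>"
proof -
  obtain B where B: "translation_bounded B g"
    by (rule translation_bounded_and_continuous_if_C_b[OF g C])
  have "L01 (hat g (y + p) - c *\<^sub>C hat g y) \<le> ennreal \<epsilon>" for y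
  proof -
    have "L01 (hat g (y + p) - c *\<^sub>C hat g y) \<le> ennreal (4 * (B + cmod c * B))"
      using B by (intro L01_diff_le) (auto simp: translation_bounded_def)
    then have "L01 (hat g (y + p) - c *\<^sub>C hat g y) < top" by (rule le_less_trans) simp
    then have "L01 (hat g (y + p) - c *\<^sub>C hat g y) = ennreal (Lq01_norm q (hat g (y + p) - c *\<^sub>C hat g y))"
      by (simp add: Lp_norm_def)
    then show ?thesis using le[of y] by (simp add: ennreal_leI)
  qed
  from norm_conv_diff_le_const[OF B B \<epsilon> this]
  have "norm (conv g (t + p) - c *\<^sub>C conv g t) \<le> enn2real (\<Sum>j. weight j) * \<epsilon>" for t .
  then show ?thesis
  proof (intro Lq01_norm_le[OF q])
    fix s :: real
    show "norm ((hat (conv g) (x + p) - c *\<^sub>C hat (conv g) x) s) \<le> enn2real (\<Sum>j. weight j) * \<epsilon>"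
      if "\<And>t. norm (conv g (t + p) - c *\<^sub>C conv g t) \<le> enn2real (\<Sum>j. weight j) * \<epsilon>"
      using that[of "x + s"] by (simp add: hat_def scaleC_fun_def algebra_simps)
  qed (use \<epsilon> in simp)
qed

text \<open>As \<open>F\<close> vanishes at negative arguments, the integrand \<open>R(s) F(t - s)\<close> lives on \<open>[0, t]\<close>, and
  this interval is mapped to itself by \<open>s \<mapsto> t - s\<close>.\<close>

lemma has_bochner_conv_finite:
  assumes F: "translation_bounded B F" and neg: "\<And>u. u < 0 \<Longrightarrow> F u = 0" and t: "0 \<le> t"
    and f: "\<And>s. 0 \<le> s \<Longrightarrow> f s = F s"
  shows "has_bochner (lebesgue_on {0..t}) (\<lambda>s. blinfun_apply (R (t - s)) (f s)) (conv F t)"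
proof -
  have M: "complete_measure (lebesgue_on {0::real..})" by (rule complete_lebesgue_on) simp
  have Mt: "complete_measure (lebesgue_on {0..t})" by (rule complete_lebesgue_on) simp
  have "has_bochner (restrict_space (lebesgue_on {0..}) {0..t}) (\<lambda>s. blinfun_apply (R s) (F (t - s))) (conv F t)"
  proof (rule has_bochner_restrict[OF M _ has_bochner_conv[OF F] nn_integral_conv_finite[OF F]])
    show "{0..t} \<in> sets (lebesgue_on {0..})" by (subst sets_restrict_space_iff) auto
    show "blinfun_apply (R s) (F (t - s)) = 0" if "s \<in> space (lebesgue_on {0..}) - {0..t}" for s
      using that neg by auto
  qed
  moreover have "restrict_space (lebesgue_on {0..}) {0..t} = lebesgue_on {0..t}"
    by (subst restrict_restrict_space) (auto simp: Int_absorb1)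
  ultimately have "has_bochner (lebesgue_on {0..t}) (\<lambda>s. blinfun_apply (R s) (F (t - s))) (conv F t)" by simp
  then have "has_bochner (lebesgue_on {0..t}) (\<lambda>s. blinfun_apply (R (t - s)) (F (t - (t - s)))) (conv F t)"
  proof (rule has_bochner_compose[where T="\<lambda>s. t - s", rotated -1])
    show "(\<lambda>s. t - s) ` space (lebesgue_on {0..t}) = space (lebesgue_on {0..t})"
      by (auto simp: image_iff intro!: bexI[of _ "t - _"])
  qed (use distr_reflect_lebesgue_on[of t t 0] Mt in simp_all)
  then show ?thesis
    by (rule has_bochner_AE_cong) (use f in \<open>auto intro!: AE_I2\<close>)
qed

text \<open>The splitting \<open>H = R * g + \<phi>\<close>. The cut-off \<open>F\<close> of \<open>f = g + h\<close> has bounded and continuous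
  Stepanov translates, so both convolutions are bounded continuous functions, and
  \<open>\<phi> = R * F - R * g\<close> tends to \<open>0\<close> even pointwise.\<close>

lemma finite_convolution_asymptotics:
  assumes g: "strongly_measurable lebesgue g" and gC: "hat g \<in> C_b (Lq01 q) (Lq01_norm q) UNIV"
    and h: "strongly_measurable (lebesgue_on {0..}) h" and hC: "hat h \<in> C_0 (Lq01 q) (Lq01_norm q)"
    and f: "\<And>t. 0 \<le> t \<Longrightarrow> f t = g t + h t"
    and H: "\<And>t. 0 \<le> t \<Longrightarrow> H t = bochner_integral (lebesgue_on {0..t}) (\<lambda>s. blinfun_apply (R (t - s)) (f s))"
  shows "\<forall>t\<ge>0. bochner_integrable (lebesgue_on {0..t}) (\<lambda>s. blinfun_apply (R (t - s)) (f s))"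
    and "bounded (H ` {0..})"
    and "stepanov_bounded q {0..} H"
    and "hat H \<in> C_b (Lq01 q) (Lq01_norm q) {0..}"
    and "hat (conv g) \<in> C_b (Lq01 q) (Lq01_norm q) UNIV"
    and "\<exists>\<phi>. \<phi> \<in> C_0 (Lq01 q) (Lq01_norm q) \<and> (\<forall>t\<ge>0. Lq01_norm q (hat H t - (hat (conv g) t + \<phi> t)) = 0)"
proof -
  obtain Bg where Bg: "translation_bounded Bg g" and gcont: "\<And>x. ((\<lambda>y. L01 (hat g y - hat g x)) \<longlongrightarrow> 0) (at x)"
    by (rule translation_bounded_and_continuous_if_C_b[OF g gC]) (rule that)
  have "hat h \<in> C_b (Lq01 q) (Lq01_norm q) {0..}" using hC by (simp add: C_0_def)
  then obtain Bh where Bh: "0 \<le> Bh" "\<And>t. 0 \<le> t \<Longrightarrow> L01 (hat h t) \<le> ennreal Bh"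
    and hcont: "\<And>t. 0 \<le> t \<Longrightarrow> ((\<lambda>s. L01 (hat h s - hat h t)) \<longlongrightarrow> 0) (at t within {0..})"
    using C_b_hatD[OF q, of h "{0..}"] by (metis atLeast_iff)
  \<comment> \<open>The values of \<open>h\<close> at negative arguments are arbitrary and may not even be measurable.\<close>
  define h0 where "h0 u = (if u \<in> {0..} then h u else 0)" for u
  define F where "F u = (if u \<in> {0..} then g u + h0 u else 0)" for u
  have h0: "strongly_measurable lebesgue h0"
    unfolding h0_def by (rule strongly_measurable_extend[OF h]) simp
  have F: "strongly_measurable lebesgue F"
    unfolding F_def
    by (intro strongly_measurable_extend strongly_measurable_lebesgue_on strongly_measurable_add g h0) simp_all
  have neg: "F u = 0" if "u < 0" for u using that by (simp add: F_def)
  have fF: "f s = F s" if "0 \<le> s" for s using f that by (simp add: F_def h0_def)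
  have hat_F: "hat F t s = hat g t s + hat h t s" if "0 \<le> t" "s \<in> {0..1}" for t s
    using that by (simp add: hat_def F_def h0_def)
  have hat_h0: "L01 (hat h0 t) = L01 (hat h t)" if "0 \<le> t" for t
    using that by (intro eLp_norm_cong[OF q]) (simp add: hat_def h0_def)
  have hat_h0_diff: "L01 (hat h0 s - hat h0 t) = L01 (hat h s - hat h t)" if "0 \<le> t" "0 \<le> s" for s t
    using that by (intro eLp_norm_cong[OF q]) (simp add: hat_def h0_def)
  have md: "(\<lambda>x. norm ((hat A s - hat A t) x)) \<in> borel_measurable (lebesgue_on {0..1})"
    if "strongly_measurable lebesgue A" for A :: "real \<Rightarrow> 'e" and s t
    unfolding fun_diff_def using that
    by (intro borel_measurable_norm_strongly_measurable complete_lebesgue_on strongly_measurable_diff strongly_measurable_hat) auto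
  define BF where "BF = 4 * (Bg + Bh)"
  have Bg0: "0 \<le> Bg" using Bg by (simp add: translation_bounded_def)
  have FB0: "L01 (hat F t) \<le> ennreal BF" if t: "0 \<le> t" for t
  proof -
    have "L01 (hat F t) \<le> 4 * (L01 (hat g t) + L01 (hat h0 t))"
    proof (rule eLp_norm_dominated_sum[OF q borel_measurable_norm_hat[OF g] borel_measurable_norm_hat[OF h0]])
      fix s :: real assume "s \<in> space (lebesgue_on {0..1})"
      then have "hat F t s = hat g t s + hat h0 t s" using t by (simp add: hat_def F_def)
      then show "norm (hat F t s) \<le> norm (hat g t s) + norm (hat h0 t s)" by (simp add: norm_triangle_ineq)
    qed
    also have "\<dots> \<le> 4 * (ennreal Bg + ennreal Bh)"
      using Bg Bh t by (intro mult_left_mono add_mono) (auto simp: hat_h0 translation_bounded_def)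
    also have "\<dots> = ennreal BF"
    proof -
      have "ennreal Bg + ennreal Bh = ennreal (Bg + Bh)" using Bg0 Bh by (intro ennreal_plus[symmetric])
      then show ?thesis unfolding BF_def using Bg0 Bh by (subst ennreal_mult) auto
    qed
    finally show ?thesis .
  qed
  have FB: "translation_bounded BF F"
    unfolding translation_bounded_def
  proof (intro conjI allI F)
    show "0 \<le> BF" using Bg0 Bh by (simp add: BF_def)
    show "L01 (hat F x) \<le> ennreal BF" for x
      using eLp_norm_hat_le_pos_part[OF q F neg, of x] FB0[of "max 0 x"] by (auto intro: order_trans)
  qed
  have Fcont0: "((\<lambda>s. L01 (hat F s - hat F t)) \<longlongrightarrow> 0) (at t within {0..})" if t: "0 \<le> t" for t
  proof (rule tendsto_sandwich[OF _ _ tendsto_const])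
    have "((\<lambda>s. L01 (hat g s - hat g t)) \<longlongrightarrow> 0) (at t within {0..})"
      by (rule tendsto_within_subset[OF gcont]) simp
    then have "((\<lambda>s. L01 (hat g s - hat g t) + L01 (hat h s - hat h t)) \<longlongrightarrow> 0 + 0) (at t within {0..})"
      by (rule tendsto_add[OF _ hcont[OF t]])
    from ennreal_tendsto_cmult[OF _ this, of 4]
    show "((\<lambda>s. 4 * (L01 (hat g s - hat g t) + L01 (hat h s - hat h t))) \<longlongrightarrow> 0) (at t within {0..})" by simp
    show "\<forall>\<^sub>F s in at t within {0..}. L01 (hat F s - hat F t) \<le> 4 * (L01 (hat g s - hat g t) + L01 (hat h s - hat h t))"
    proof (rule eventually_mono[OF eventually_within_in])
      fix s :: real assume s: "s \<in> {0..}"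
      have "L01 (hat F s - hat F t) \<le> 4 * (L01 (hat g s - hat g t) + L01 (hat h0 s - hat h0 t))"
      proof (rule eLp_norm_dominated_sum[OF q md[OF g] md[OF h0]])
        fix x :: real assume "x \<in> space (lebesgue_on {0..1})"
        then have "(hat F s - hat F t) x = (hat g s - hat g t) x + (hat h0 s - hat h0 t) x"
          using t s by (simp add: hat_def F_def)
        then show "norm ((hat F s - hat F t) x) \<le> norm ((hat g s - hat g t) x) + norm ((hat h0 s - hat h0 t) x)"
          by (simp only: norm_triangle_ineq)
      qed
      then show "L01 (hat F s - hat F t) \<le> 4 * (L01 (hat g s - hat g t) + L01 (hat h s - hat h t))"
        using s t by (simp add: hat_h0_diff)
    qed
  qed simp
  have Fcont: "((\<lambda>y. L01 (hat F y - hat F x)) \<longlongrightarrow> 0) (at x)" for x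
    by (rule hat_truncated_continuous[OF q F neg _ Fcont0]) (use FB0[of 0] in \<open>auto intro: le_less_trans\<close>)
  note convF = conv_continuous[OF FB Fcont] conv_bounded[OF FB]
  note convg = conv_continuous[OF Bg gcont] conv_bounded[OF Bg]
  have HF: "H t = conv F t" if "0 \<le> t" for t
    unfolding H[OF that] by (rule bochner_integral_eq[OF complete_lebesgue_on has_bochner_conv_finite[OF FB neg that fF]]) simp_all
  show "\<forall>t\<ge>0. bochner_integrable (lebesgue_on {0..t}) (\<lambda>s. blinfun_apply (R (t - s)) (f s))"
    unfolding bochner_integrable_def using has_bochner_conv_finite[OF FB neg _ fF] by blast
  show "bounded (H ` {0..})"
    unfolding bounded_iff using convF(2) HF by auto
  show "stepanov_bounded q {0..} H"
    by (rule stepanov_bounded_continuous[OF q convF HF])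
  show "hat H \<in> C_b (Lq01 q) (Lq01_norm q) {0..}"
    by (rule hat_C_b_cong[OF q hat_continuous_in_C_b[OF q convF]]) (simp add: HF)
  show "hat (conv g) \<in> C_b (Lq01 q) (Lq01_norm q) UNIV"
    by (rule hat_continuous_in_C_b[OF q convg])
  define P where "P t = conv F t - conv g t" for t
  have P: "continuous_on UNIV P" unfolding P_def by (intro continuous_on_diff convF convg)
  have PB: "norm (P t) \<le> enn2real (\<Sum>j. weight j) * (4 * BF) + enn2real (\<Sum>j. weight j) * (4 * Bg)" for t
    unfolding P_def using norm_triangle_ineq4[of "conv F t" "conv g t"] convF(2)[of t] convg(2)[of t] by linarith
  have Plim: "(P \<longlongrightarrow> 0) at_top"
    unfolding P_def
  proof (rule conv_tendsto[OF FB Bg])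
    fix j
    have "((\<lambda>t. ennreal (Lq01_norm q (hat h t))) \<longlongrightarrow> 0) at_top"
      using hC tendsto_ennrealI by (fastforce simp: C_0_def)
    then have "((\<lambda>t. ennreal (Lq01_norm q (hat h (t - real j - 1)))) \<longlongrightarrow> 0) at_top"
      by (rule filterlim_compose) real_asymp
    moreover have "\<forall>\<^sub>F t in at_top. ennreal (Lq01_norm q (hat h (t - real j - 1))) = L01 (hat F (t - real j - 1) - hat g (t - real j - 1))"
      \<comment> \<open>From \<open>t = j + 1\<close> on, the window \<open>[t - j - 1, t - j]\<close> lies in \<open>[0, \<infinity>)\<close>, where \<open>F - g = h\<close>.\<close>
      using eventually_ge_at_top[of "real j + 1"]
    proof eventually_elim
      case (elim t)
      then have t: "0 \<le> t - real j - 1" by simp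
      have "L01 (hat F (t - real j - 1) - hat g (t - real j - 1)) = L01 (hat h (t - real j - 1))"
        using hat_F[OF t] by (intro eLp_norm_cong[OF q]) simp
      moreover have "L01 (hat h (t - real j - 1)) < top" using Bh(2)[OF t] by (rule le_less_trans) simp
      ultimately show ?case by (simp add: Lp_norm_def)
    qed
    ultimately show "((\<lambda>t. L01 (hat F (t - real j - 1) - hat g (t - real j - 1))) \<longlongrightarrow> 0) at_top"
      by (rule Lim_transform_eventually)
  qed
  show "\<exists>\<phi>. \<phi> \<in> C_0 (Lq01 q) (Lq01_norm q) \<and> (\<forall>t\<ge>0. Lq01_norm q (hat H t - (hat (conv g) t + \<phi> t)) = 0)"
  proof (intro exI[of _ "hat P"] conjI allI impI)
    show "hat P \<in> C_0 (Lq01 q) (Lq01_norm q)" by (rule hat_continuous_in_C_0[OF q P PB Plim])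
    fix t :: real assume "0 \<le> t"
    then have "Lq01_norm q (hat H t - (hat (conv g) t + hat P t)) \<le> 0"
      by (intro Lq01_norm_le[OF q]) (auto simp: hat_def HF P_def)
    then show "Lq01_norm q (hat H t - (hat (conv g) t + hat P t)) = 0"
      using Lq01_norm_nonneg by (intro antisym)
  qed
qed

end

theorem proposition4p2:
  fixes R :: "real \<Rightarrow> ('e::{complex_normed_vector, banach} \<Rightarrow>\<^sub>L 'x::{complex_normed_vector, banach})"
    and k q M :: real
    and q' :: ennreal
    and m :: "real \<Rightarrow> ennreal"
    and f g h :: "real \<Rightarrow> 'e"
    and H :: "real \<Rightarrow> 'x"
  assumes q: "1 \<le> q" and q': "1 / q' + 1 / ennreal q = 1"
    and R_linear: "\<And>t. t > 0 \<Longrightarrow> complex_linear (blinfun_apply (R t))"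
    and R_cont: "strongly_continuous_on {0<..} R"
    and m_def: "\<And>s. s \<ge> 0 \<Longrightarrow> m s = (\<Sum>j. eLp_norm q' (lebesgue_on {s + real j..s + real j + 1}) R)"
    and m_finite: "\<And>s. s \<ge> 0 \<Longrightarrow> m s < \<infinity>"
    and g: "stepanov_bounded q UNIV g"
    and h: "stepanov_bounded q {0..} h"
    and h_C0: "hat h \<in> C_0 (Lq01 q) (Lq01_norm q)"
    and f_def: "\<And>t. t \<ge> 0 \<Longrightarrow> f t = g t + h t"
    and M: "M > 0"
    and i: "((\<lambda>t. \<integral>\<^sup>+s. ennreal_powr
               (\<integral>\<^sup>+r. ennreal (norm (R r) * norm (h (s - r))) \<partial>lebesgue_on {M..s}) q
             \<partial>lebesgue_on {t..t+1}) \<longlongrightarrow> 0) at_top"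
    and ii: "((\<lambda>t. \<integral>\<^sup>+s. ennreal_powr (m s) q \<partial>lebesgue_on {t..t+1}) \<longlongrightarrow> 0) at_top"
    and H_def: "\<And>t. t \<ge> 0 \<Longrightarrow>
             H t = bochner_integral (lebesgue_on {0..t}) (\<lambda>s. blinfun_apply (R (t - s)) (f s))"
  shows "(stepanov_semi_bloch_periodic q k g \<longrightarrow>
            (\<forall>t\<ge>0. bochner_integrable (lebesgue_on {0..t}) (\<lambda>s. blinfun_apply (R (t - s)) (f s))) \<and>
            bounded (H ` {0..}) \<and>
            asymptotically_stepanov_semi_bloch_periodic q k H) \<and>
         (stepanov_semi_anti_periodic q g \<longrightarrow>
            (\<forall>t\<ge>0. bochner_integrable (lebesgue_on {0..t}) (\<lambda>s. blinfun_apply (R (t - s)) (f s))) \<and>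
            bounded (H ` {0..}) \<and>
            asymptotically_stepanov_semi_anti_periodic q H)"
proof -
  interpret summable_kernel R q q'
  proof
    show "(\<Sum>j. eLp_norm q' (lebesgue_on {real j..real j + 1}) R) < \<infinity>"
      using m_def[of 0] m_finite[of 0] by simp
  qed (fact q q' R_linear R_cont)+
  have gm: "strongly_measurable lebesgue g"
    using Lp_loc_strongly_measurable[of g "ennreal q" UNIV] g
    by (simp add: stepanov_bounded_def lebesgue_on_UNIV_eq)
  have hm: "strongly_measurable (lebesgue_on {0..}) h"
    using Lp_loc_strongly_measurable[of h "ennreal q" "{0..}"] h by (simp add: stepanov_bounded_def)
  note asymptotics = finite_convolution_asymptotics[OF gm _ hm h_C0 f_def H_def]
  \<comment> \<open>One more than the total weight, in order to divide by it.\<close>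
  define K where "K = enn2real (\<Sum>j. weight j) + 1"
  have K: "0 < K" "enn2real (\<Sum>j. weight j) \<le> K" by (simp_all add: K_def add_nonneg_pos)
  have period: "Lq01_norm q (hat (conv g) (x + p) - c *\<^sub>C hat (conv g) x) \<le> \<epsilon>"
    if "hat g \<in> C_b (Lq01 q) (Lq01_norm q) UNIV" "0 < \<epsilon>" "\<And>x. Lq01_norm q (hat g (x + p) - c *\<^sub>C hat g x) \<le> \<epsilon> / K"
    for \<epsilon> p c x
  proof -
    have "Lq01_norm q (hat (conv g) (x + p) - c *\<^sub>C hat (conv g) x) \<le> enn2real (\<Sum>j. weight j) * (\<epsilon> / K)"
      using that K by (intro conv_almost_period gm) auto
    also have "\<dots> \<le> K * (\<epsilon> / K)" using K that by (intro mult_right_mono) auto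
    finally show ?thesis using K by simp
  qed
  show ?thesis
  proof (intro conjI impI)
    assume "stepanov_semi_bloch_periodic q k g"
    then have gC: "hat g \<in> C_b (Lq01 q) (Lq01_norm q) UNIV"
      and gp: "\<And>\<epsilon>. 0 < \<epsilon> \<Longrightarrow> \<exists>p>0. \<forall>m::int. \<forall>x.
        Lq01_norm q (hat g (x + of_int m * p) - exp (\<i> * complex_of_real (k * of_int m * p)) *\<^sub>C hat g x) \<le> \<epsilon>"
      by (auto simp: stepanov_semi_bloch_periodic_def semi_bloch_periodic_def)
    note A = asymptotics[OF gC]
    have "semi_bloch_periodic (Lq01 q) (Lq01_norm q) k (hat (conv g))"
      unfolding semi_bloch_periodic_def
    proof (intro conjI allI impI)
      fix \<epsilon> :: real assume \<epsilon>: "0 < \<epsilon>"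
      then have "0 < \<epsilon> / K" using K by simp
      from gp[OF this] show "\<exists>p>0. \<forall>m::int. \<forall>x. Lq01_norm q (hat (conv g) (x + of_int m * p)
          - exp (\<i> * complex_of_real (k * of_int m * p)) *\<^sub>C hat (conv g) x) \<le> \<epsilon>"
        using period[OF gC \<epsilon>] by blast
    qed (rule A(5))
    with A(3,4,6) show "asymptotically_stepanov_semi_bloch_periodic q k H"
      unfolding asymptotically_stepanov_semi_bloch_periodic_def asymptotically_semi_bloch_periodic_def by blast
    show "bounded (H ` {0..})" by (rule A(2))
    show "\<forall>t\<ge>0. bochner_integrable (lebesgue_on {0..t}) (\<lambda>s. blinfun_apply (R (t - s)) (f s))"
      by (rule A(1))
  next
    assume "stepanov_semi_anti_periodic q g"
    then have gC: "hat g \<in> C_b (Lq01 q) (Lq01_norm q) UNIV"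
      and gp: "\<And>\<epsilon>. 0 < \<epsilon> \<Longrightarrow> \<exists>p>0. \<forall>m::int. \<forall>x.
        Lq01_norm q (hat g (x + of_int m * p) - ((-1) powi m) *\<^sub>C hat g x) \<le> \<epsilon>"
      by (auto simp: stepanov_semi_anti_periodic_def semi_anti_periodic_def)
    note A = asymptotics[OF gC]
    have "semi_anti_periodic (Lq01 q) (Lq01_norm q) (hat (conv g))"
      unfolding semi_anti_periodic_def
    proof (intro conjI allI impI)
      fix \<epsilon> :: real assume \<epsilon>: "0 < \<epsilon>"
      then have "0 < \<epsilon> / K" using K by simp
      from gp[OF this] show "\<exists>p>0. \<forall>m::int. \<forall>x. Lq01_norm q (hat (conv g) (x + of_int m * p)
          - ((-1) powi m) *\<^sub>C hat (conv g) x) \<le> \<epsilon>"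
        using period[OF gC \<epsilon>] by blast
    qed (rule A(5))
    with A(3,4,6) show "asymptotically_stepanov_semi_anti_periodic q H"
      unfolding asymptotically_stepanov_semi_anti_periodic_def asymptotically_semi_anti_periodic_def by blast
    show "bounded (H ` {0..})" by (rule A(2))
    show "\<forall>t\<ge>0. bochner_integrable (lebesgue_on {0..t}) (\<lambda>s. blinfun_apply (R (t - s)) (f s))"
      by (rule A(1))
  qed
qed

end
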